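(* Let $\mathcal H$ be an infinite dimensional Hilbert space and let $\mathcal K$ denote the Banach algebra $S_2(\mathcal H)$ of Hilbert-Schmidt operators on $\mathcal H$ (with composition as multiplication), which is also a Hilbert space. Then the Banach algebra $B(\mathcal K)\otimes^\gamma\mathcal K$ (the projective tensor product) is not Arens regular, where $B(\mathcal K)$ is the Banach algebra of bounded linear operators on the Hilbert space $\mathcal K$.
   Context: Hilbert spaces are complex. For a Hilbert space $\mathcal H$, $S_2(\mathcal H)$ is the space of Hilbert-Schmidt operators on $\mathcal H$, a Hilbert space with inner product $\langle A,B\rangle=\operatorname{Tr}(B^*A)$, and a Banach algebra under composition of operators with the corresponding norm. Projective tensor product: for Banach algebras $A,B$, the algebraic tensor product $A\otimes B$ has multiplication determined by $(x_1\otimes y_1)(x_2\otimes y_2)=x_1x_2\otimes y_1y_2$ and norm $\|u\|_\gamma=\inf\{\sum_{i=1}^n\|x_i\|\|y_i\| : u=\sum_{i=1}^n x_i\otimes y_i\}$; its completion is the Banach algebra $A\otimes^\gamma B$. Arens regularity: let $A$ be a normed algebra. For $a\in A$, $\omega\in A^*$, $f\in A^{**}$ define $\omega_a,{}_a\omega\in A^*$ by $\omega_a(b)=\omega(ab)$, ${}_a\omega(b)=\omega(ba)$, and $\omega_f,{}_f\omega\in A^*$ by $\omega_f(a)=f({}_a\omega)$, ${}_f\omega(a)=f(\omega_a)$. For $f,g\in A^{**}$ set $(f\Box g)(\omega)=f({}_g\omega)$ and $(f\diamond g)(\omega)=g(\omega_f)$ for $\omega\in A^*$. $A$ is Arens regular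 if $f\Box g=f\diamond g$ for all $f,g\in A^{**}$. *)

theory Defs
  imports "HOL-Analysis.Analysis"
begin

section \<open>Complex vector spaces, normed algebras and Hilbert spaces\<close>

class scaleC = scaleR +
  fixes scaleC :: "complex \<Rightarrow> 'a \<Rightarrow> 'a"  (infixr \<open>*\<^sub>C\<close> 75)
  assumes scaleR_scaleC: "r *\<^sub>R x = complex_of_real r *\<^sub>C x"

class complex_vector = scaleC + ab_group_add +
  assumes scaleC_add_right: "a *\<^sub>C (x + y) = a *\<^sub>C x + a *\<^sub>C y"
    and scaleC_add_left: "(a + b) *\<^sub>C x = a *\<^sub>C x + b *\<^sub>C x"
    and scaleC_scaleC: "a *\<^sub>C b *\<^sub>C x = (a * b) *\<^sub>C x"
    and scaleC_one: "1 *\<^sub>C x = x"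
begin

subclass real_vector
  by standard (simp_all add: scaleR_scaleC scaleC_add_right scaleC_add_left scaleC_scaleC scaleC_one)

end

global_interpretation complex_vector: vector_space "scaleC :: complex \<Rightarrow> 'a \<Rightarrow> 'a::complex_vector"
  by standard (simp_all add: scaleC_add_right scaleC_add_left scaleC_scaleC scaleC_one)

lemma scaleC_minus_left: "(- a) *\<^sub>C (x::'a::complex_vector) = - (a *\<^sub>C x)"
  and scaleC_minus_right: "a *\<^sub>C (- x) = - (a *\<^sub>C x)"
  and scaleC_diff_right: "a *\<^sub>C (x - y) = a *\<^sub>C x - a *\<^sub>C y"
  and scaleC_minus1: "(- 1) *\<^sub>C x = - x"
  by (simp_all add: complex_vector.scale_right_diff_distrib)

class complex_normed_vector = complex_vector + real_normed_vector +
  assumes norm_scaleC: "norm (a *\<^sub>C x) = cmod a * norm x"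

class complex_algebra = complex_vector + ring +
  assumes mult_scaleC_left: "(a *\<^sub>C x) * y = a *\<^sub>C (x * y)"
    and mult_scaleC_right: "x * (a *\<^sub>C y) = a *\<^sub>C (x * y)"

class complex_normed_algebra = complex_algebra + complex_normed_vector + real_normed_algebra

class complex_banach_algebra = complex_normed_algebra + complete_space

instantiation complex :: complex_banach_algebra
begin

definition scaleC_complex :: "complex \<Rightarrow> complex \<Rightarrow> complex"
  where "scaleC_complex a x = a * x"

instance
  by standard (simp_all add: scaleC_complex_def scaleR_conv_of_real algebra_simps norm_mult)

end

text \<open>The inner product is linear in the first argument.\<close>

text \<open>Vector spaces with an inner product are introduced before their norm, so that the norm axioms
  of a concrete inner product space can be obtained from \<open>inorm\<close>.\<close>

class complex_inner_space = complex_vector +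
  fixes cinner :: "'a \<Rightarrow> 'a \<Rightarrow> complex"
  assumes cinner_commute: "cinner x y = cnj (cinner y x)"
    and cinner_add_left: "cinner (x + y) z = cinner x z + cinner y z"
    and cinner_scaleC_left: "cinner (a *\<^sub>C x) y = a * cinner x y"
    and cinner_ge_zero: "0 \<le> Re (cinner x x)"
    and cinner_eq_zero_iff: "cinner x x = 0 \<longleftrightarrow> x = 0"
begin

definition inorm :: "'a \<Rightarrow> real"
  where "inorm x = sqrt (Re (cinner x x))"

lemma cinner_add_right: "cinner x (y + z) = cinner x y + cinner x z"
  by (metis cinner_commute cinner_add_left complex_cnj_add)

lemma cinner_scaleC_right: "cinner x (a *\<^sub>C y) = cnj a * cinner x y"
  by (metis cinner_commute cinner_scaleC_left complex_cnj_mult)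

lemma cinner_zero_left [simp]: "cinner 0 x = 0"
  using cinner_add_left [of 0 0 x] by simp

lemma cinner_zero_right [simp]: "cinner x 0 = 0"
  using cinner_add_right [of x 0 0] by simp

lemma cinner_minus_left: "cinner (- x) y = - cinner x y"
  using cinner_add_left [of x "- x" y] by (simp add: group_add_class.add_eq_0_iff)

lemma cinner_minus_right: "cinner x (- y) = - cinner x y"
  using cinner_add_right [of x y "- y"] by (simp add: group_add_class.add_eq_0_iff)

lemma cinner_diff_left: "cinner (x - y) z = cinner x z - cinner y z"
  using cinner_add_left [of x "- y" z] by (simp add: cinner_minus_left)

lemma cinner_diff_right: "cinner x (y - z) = cinner x y - cinner x z"
  using cinner_add_right [of x y "- z"] by (simp add: cinner_minus_right)

lemma Im_cinner_self: "Im (cinner x x) = 0"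
  using cinner_commute [of x x] by (simp add: complex_eq_iff)

lemma inorm_ge_zero: "0 \<le> inorm x"
  by (simp add: inorm_def cinner_ge_zero)

lemma power2_inorm: "(inorm x)\<^sup>2 = Re (cinner x x)"
  by (simp add: inorm_def cinner_ge_zero)

lemma cinner_inorm: "cinner x x = complex_of_real ((inorm x)\<^sup>2)"
  by (simp add: power2_inorm complex_eq_iff Im_cinner_self del: of_real_power)

lemma inorm_eq_zero: "inorm x = 0 \<longleftrightarrow> x = 0"
  by (metis cinner_eq_zero_iff cinner_inorm of_real_0 power2_inorm zero_complex.sel(1)
      zero_eq_power2)

lemma inorm_diff_proj:
  assumes "y \<noteq> 0"
  shows "(inorm (x - (cinner x y / cinner y y) *\<^sub>C y))\<^sup>2 = (inorm x)\<^sup>2 - (cmod (cinner x y))\<^sup>2 / (inorm y)\<^sup>2"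
proof -
  let ?t = "cinner x y / cinner y y"
  have yy: "cinner y y \<noteq> 0" using assms by (simp add: cinner_eq_zero_iff)
  have "cinner (x - ?t *\<^sub>C y) (x - ?t *\<^sub>C y) = cinner x x - cnj ?t * cinner x y - ?t * cinner y x + ?t * cnj ?t * cinner y y"
    by (simp add: cinner_diff_left cinner_diff_right cinner_scaleC_left cinner_scaleC_right algebra_simps)
  also have "?t * cnj ?t * cinner y y = cnj ?t * cinner x y"
    using yy by simp
  also have "?t * cinner y x = (cinner x y * cnj (cinner x y)) / cinner y y"
    by (metis cinner_commute times_divide_eq_left)
  also have "cinner x y * cnj (cinner x y) = complex_of_real ((cmod (cinner x y))\<^sup>2)"
    by (metis complex_norm_square)
  finally have "cinner (x - ?t *\<^sub>C y) (x - ?t *\<^sub>C y) = complex_of_real ((inorm x)\<^sup>2 - (cmod (cinner x y))\<^sup>2 / (inorm y)\<^sup>2)"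
    unfolding cinner_inorm [of x] cinner_inorm [of y] by simp
  then show ?thesis
    by (metis Re_complex_of_real power2_inorm)
qed

lemma inorm_Cauchy_Schwarz: "cmod (cinner x y) \<le> inorm x * inorm y"
proof (cases "y = 0")
  case True
  then show ?thesis using inorm_ge_zero [of x] inorm_ge_zero [of y] by simp
next
  case False
  then have "(inorm y)\<^sup>2 > 0" by (simp add: inorm_eq_zero)
  moreover have "0 \<le> (inorm x)\<^sup>2 - (cmod (cinner x y))\<^sup>2 / (inorm y)\<^sup>2"
    using inorm_diff_proj [OF False, of x] by (metis zero_le_power2)
  ultimately have "(cmod (cinner x y))\<^sup>2 \<le> (inorm x * inorm y)\<^sup>2"
    by (simp add: field_simps power_mult_distrib)
  then show ?thesis
    by (rule power2_le_imp_le) (simp add: inorm_ge_zero)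
qed

lemma inorm_add_square: "(inorm (x + y))\<^sup>2 = (inorm x)\<^sup>2 + (inorm y)\<^sup>2 + 2 * Re (cinner x y)"
proof -
  have "Re (cinner y x) = Re (cinner x y)" by (subst cinner_commute) simp
  then show ?thesis by (simp add: power2_inorm cinner_add_left cinner_add_right)
qed

lemma inorm_scaleC: "inorm (a *\<^sub>C x) = cmod a * inorm x"
proof -
  have "cinner (a *\<^sub>C x) (a *\<^sub>C x) = a * cnj a * cinner x x"
    by (simp add: cinner_scaleC_left cinner_scaleC_right)
  also have "\<dots> = complex_of_real ((cmod a * inorm x)\<^sup>2)"
    by (simp only: complex_norm_square [symmetric] cinner_inorm power_mult_distrib of_real_mult)
  finally have "(inorm (a *\<^sub>C x))\<^sup>2 = (cmod a * inorm x)\<^sup>2"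
    by (metis Re_complex_of_real power2_inorm)
  then show ?thesis using inorm_ge_zero by simp
qed

lemma inorm_triangle: "inorm (x + y) \<le> inorm x + inorm y"
proof (rule power2_le_imp_le)
  have "Re (cinner x y) \<le> inorm x * inorm y"
    using inorm_Cauchy_Schwarz [of x y] complex_Re_le_cmod [of "cinner x y"] by linarith
  then show "(inorm (x + y))\<^sup>2 \<le> (inorm x + inorm y)\<^sup>2"
    by (simp add: inorm_add_square power2_sum)
qed (simp add: inorm_ge_zero)

end

class complex_inner = complex_inner_space + complex_normed_vector +
  assumes norm_eq_sqrt_cinner: "norm x = sqrt (Re (cinner x x))"

lemma norm_eq_inorm: "norm (x::'a::complex_inner) = inorm x"
  by (simp add: norm_eq_sqrt_cinner inorm_def)

lemmas cinner_self = cinner_inorm [where 'a = "'a::complex_inner", folded norm_eq_inorm]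
  and norm_diff_proj = inorm_diff_proj [where 'a = "'a::complex_inner", folded norm_eq_inorm]
  and cinner_Cauchy_Schwarz = inorm_Cauchy_Schwarz [where 'a = "'a::complex_inner", folded norm_eq_inorm]
  and norm_add_square = inorm_add_square [where 'a = "'a::complex_inner", folded norm_eq_inorm]

class chilbert_space = complex_inner + complete_space
begin

subclass banach ..

end

lemma parallelogram: "(norm (x + y))\<^sup>2 + (norm (x - y))\<^sup>2 = 2 * (norm x)\<^sup>2 + 2 * (norm (y::'a::complex_inner))\<^sup>2"
  using norm_add_square [of x y] norm_add_square [of x "- y"] by (simp add: cinner_minus_right)

lemma bounded_bilinear_cinner_aux: "norm (cinner x y) \<le> norm x * norm (y::'a::complex_inner) * 1"
  using cinner_Cauchy_Schwarz [of x y] by simp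

lemma bounded_bilinear_cinner: "bounded_bilinear (cinner :: 'a::complex_inner \<Rightarrow> 'a \<Rightarrow> complex)"
proof
  show "\<exists>K. \<forall>a b::'a. norm (cinner a b) \<le> norm a * norm b * K"
    using bounded_bilinear_cinner_aux by blast
qed (simp_all add: cinner_add_left cinner_add_right scaleR_scaleC cinner_scaleC_left cinner_scaleC_right scaleC_complex_def)

lemma exists_orthogonal:
  fixes M :: "'a::chilbert_space set"
  assumes M: "complex_vector.subspace M" and cl: "closed M" and ne: "M \<noteq> UNIV"
  obtains y where "y \<noteq> 0" "\<And>v. v \<in> M \<Longrightarrow> cinner y v = 0"
proof -
  obtain x where x: "x \<notin> M" using ne by blast
  have M0: "M \<noteq> {}" using complex_vector.subspace_0 [OF M] by blast
  define d where "d = infdist x M"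
  have d0: "0 \<le> d" by (simp add: d_def infdist_nonneg)
  have dle: "d \<le> norm (x - v)" if "v \<in> M" for v
    using infdist_le [OF that, of x] by (simp add: d_def dist_norm)
  have "\<exists>v\<in>M. norm (x - v) < d + inverse (real (Suc n))" for n
  proof -
    have "infdist x M < d + inverse (real (Suc n))" by (simp add: d_def)
    then have "Inf (dist x ` M) < d + inverse (real (Suc n))"
      by (simp only: infdist_notempty [OF M0])
    then show ?thesis
      using cInf_lessD [of "dist x ` M" "d + inverse (real (Suc n))"] M0 by (auto simp: dist_norm)
  qed
  then obtain m where mM: "\<And>n. m n \<in> M" and m: "\<And>n. norm (x - m n) < d + inverse (real (Suc n))"
    by metis
  have lim1: "(\<lambda>n. d + inverse (real (Suc n))) \<longlonglongrightarrow> d"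
    using tendsto_add [OF tendsto_const LIMSEQ_inverse_real_of_nat, of d] by simp
  have normlim: "(\<lambda>n. norm (x - m n)) \<longlonglongrightarrow> d"
    by (rule real_tendsto_sandwich [OF _ _ tendsto_const lim1])
       (use dle mM m in \<open>auto intro!: always_eventually less_imp_le\<close>)
  have "Cauchy m"
  proof (rule CauchyI)
    fix e :: real assume e: "e > 0"
    have "(\<lambda>n. (norm (x - m n))\<^sup>2) \<longlonglongrightarrow> d\<^sup>2" by (intro tendsto_power normlim)
    then have "eventually (\<lambda>n. (norm (x - m n))\<^sup>2 < d\<^sup>2 + e\<^sup>2 / 4) sequentially"
      using e by (intro order_tendstoD(2)) auto
    then obtain N where N: "\<And>n. n \<ge> N \<Longrightarrow> (norm (x - m n))\<^sup>2 < d\<^sup>2 + e\<^sup>2 / 4"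
      by (auto simp: eventually_sequentially)
    have "norm (m p - m q) < e" if "p \<ge> N" "q \<ge> N" for p q
    proof -
      define c where "c = (1/2::complex) *\<^sub>C (m p + m q)"
      have "c \<in> M" unfolding c_def
        using M mM by (simp add: complex_vector.subspace_add complex_vector.subspace_scale)
      then have dc: "d\<^sup>2 \<le> (norm (x - c))\<^sup>2" using dle d0 by (simp add: power_mono)
      have "(x - m p) + (x - m q) = (2::complex) *\<^sub>C (x - c)"
        using scaleC_add_left [of 1 1 x]
        by (simp add: c_def scaleC_diff_right scaleC_scaleC scaleC_one algebra_simps)
      then have "(norm ((x - m p) + (x - m q)))\<^sup>2 = 4 * (norm (x - c))\<^sup>2"
        by (simp add: norm_scaleC power_mult_distrib)
      moreover have "(norm ((x - m p) - (x - m q)))\<^sup>2 = (norm (m p - m q))\<^sup>2"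
        by (simp add: norm_minus_commute)
      ultimately have "(norm (m p - m q))\<^sup>2 = 2 * (norm (x - m p))\<^sup>2 + 2 * (norm (x - m q))\<^sup>2 - 4 * (norm (x - c))\<^sup>2"
        using parallelogram [of "x - m p" "x - m q"] by simp
      also have "\<dots> < e\<^sup>2" using N [OF that(1)] N [OF that(2)] dc by simp
      finally show ?thesis using e power2_less_imp_less by fastforce
    qed
    then show "\<exists>M. \<forall>p\<ge>M. \<forall>q\<ge>M. norm (m p - m q) < e" by blast
  qed
  then obtain l where l: "m \<longlonglongrightarrow> l" using Cauchy_convergent_iff convergent_def by blast
  have lM: "l \<in> M" using closed_sequentially [OF cl] mM l by blast
  have nl: "norm (x - l) = d"
    using LIMSEQ_unique [OF normlim tendsto_norm [OF tendsto_diff [OF tendsto_const l]]] by simp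
  have "cinner (x - l) v = 0" if v: "v \<in> M" for v
  proof (cases "v = 0")
    case False
    let ?t = "cinner (x - l) v / cinner v v"
    have "l + ?t *\<^sub>C v \<in> M" using M lM v
      by (simp add: complex_vector.subspace_add complex_vector.subspace_scale)
    then have "d \<le> norm (x - l - ?t *\<^sub>C v)" using dle by (simp add: diff_diff_add)
    then have "d\<^sup>2 \<le> d\<^sup>2 - (cmod (cinner (x - l) v))\<^sup>2 / (norm v)\<^sup>2"
      using norm_diff_proj [OF False, of "x - l"] d0 by (metis nl power_mono)
    then have "(cmod (cinner (x - l) v))\<^sup>2 / (norm v)\<^sup>2 \<le> 0" by simp
    moreover have "(norm v)\<^sup>2 > 0" using False by simp
    ultimately have "(cmod (cinner (x - l) v))\<^sup>2 \<le> 0" by (simp add: divide_le_0_iff)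
    then show ?thesis by simp
  qed simp
  moreover have "x - l \<noteq> 0" using x lM by auto
  ultimately show ?thesis using that by blast
qed

section \<open>Bounded linear maps\<close>

abbreviation clinear :: "('a::complex_vector \<Rightarrow> 'b::complex_vector) \<Rightarrow> bool"
  where "clinear \<equiv> Vector_Spaces.linear scaleC scaleC"

lemma clinearI:
  assumes "\<And>x y. f (x + y) = f x + f y" "\<And>c x. f (c *\<^sub>C x) = c *\<^sub>C f x"
  shows "clinear f"
  by (intro Vector_Spaces.linear.intro module_hom.intro module_hom_axioms.intro)
     (use assms in \<open>simp_all add: complex_vector.vector_space_axioms complex_vector.module_axioms\<close>)

lemma clinear_add: "clinear f \<Longrightarrow> f (x + y) = f x + f y"
  and clinear_scale: "clinear f \<Longrightarrow> f (c *\<^sub>C x) = c *\<^sub>C f x"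
  and clinear_0: "clinear f \<Longrightarrow> f 0 = 0"
  and clinear_neg: "clinear f \<Longrightarrow> f (- x) = - f x"
  and clinear_diff: "clinear f \<Longrightarrow> f (x - y) = f x - f y"
  and clinear_sum: "clinear f \<Longrightarrow> f (sum g S) = (\<Sum>i\<in>S. f (g i))"
  using module_hom.add [of scaleC scaleC f x y] module_hom.scale [of scaleC scaleC f c x]
    module_hom.zero [of scaleC scaleC f] module_hom.neg [of scaleC scaleC f x]
    module_hom.diff [of scaleC scaleC f x y] module_hom.sum [of scaleC scaleC f g S]
    Vector_Spaces.linear.axioms(3) [of scaleC scaleC f]
  by argo+

lemma clinear_iff: "clinear f \<longleftrightarrow> (\<forall>x y. f (x + y) = f x + f y) \<and> (\<forall>c x. f (c *\<^sub>C x) = c *\<^sub>C f x)"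
  using clinearI [of f] clinear_add [of f] clinear_scale [of f] by blast

definition bounded_clinear :: "('a::complex_normed_vector \<Rightarrow> 'b::complex_normed_vector) \<Rightarrow> bool"
  where "bounded_clinear f \<longleftrightarrow> clinear f \<and> (\<exists>K. \<forall>x. norm (f x) \<le> K * norm x)"

lemma bounded_clinearD: "bounded_clinear f \<Longrightarrow> clinear f"
  by (simp add: bounded_clinear_def)

lemma bounded_clinear_iff: "bounded_clinear f \<longleftrightarrow> bounded_linear f \<and> (\<forall>c x. f (c *\<^sub>C x) = c *\<^sub>C f x)"
  unfolding bounded_clinear_def bounded_linear_def bounded_linear_axioms_def linear_iff clinear_iff
  by (auto simp: scaleR_scaleC mult.commute)

lemma bounded_clinear_bounded_linear: "bounded_clinear f \<Longrightarrow> bounded_linear f"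
  by (simp add: bounded_clinear_iff)

lemma bounded_clinearI:
  assumes "\<And>x y. f (x + y) = f x + f y" "\<And>c x. f (c *\<^sub>C x) = c *\<^sub>C f x" "\<And>x. norm (f x) \<le> K * norm x"
  shows "bounded_clinear f"
  unfolding bounded_clinear_def using clinearI assms by blast

lemma bounded_clinear_zero: "bounded_clinear (\<lambda>x. 0)"
  by (rule bounded_clinearI [where K = 0]) simp_all

lemma bounded_clinear_ident: "bounded_clinear (\<lambda>x. x)"
  by (rule bounded_clinearI [where K = 1]) simp_all

lemma bounded_clinear_add: "bounded_clinear f \<Longrightarrow> bounded_clinear g \<Longrightarrow> bounded_clinear (\<lambda>x. f x + g x)"
  by (simp add: bounded_clinear_iff bounded_linear_add scaleC_add_right)

lemma bounded_clinear_minus: "bounded_clinear f \<Longrightarrow> bounded_clinear (\<lambda>x. - f x)"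
  by (simp add: bounded_clinear_iff bounded_linear_minus scaleC_minus_right)

lemma bounded_clinear_sub: "bounded_clinear f \<Longrightarrow> bounded_clinear g \<Longrightarrow> bounded_clinear (\<lambda>x. f x - g x)"
  by (simp add: bounded_clinear_iff bounded_linear_sub scaleC_diff_right)

lemma bounded_clinear_scaleC: "bounded_clinear f \<Longrightarrow> bounded_clinear (\<lambda>x. c *\<^sub>C f x)"
proof -
  assume f: "bounded_clinear f"
  then obtain K where "\<forall>x. norm (f x) \<le> K * norm x" by (auto simp: bounded_clinear_def)
  then have "norm (c *\<^sub>C f x) \<le> (cmod c * K) * norm x" for x
    by (simp add: norm_scaleC mult.assoc mult_left_mono)
  then show ?thesis
    using f by (intro bounded_clinearI [where K = "cmod c * K"])
      (simp_all add: clinear_add clinear_scale bounded_clinearD scaleC_add_right scaleC_scaleC mult.commute)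
qed

lemma bounded_clinear_compose: "bounded_clinear f \<Longrightarrow> bounded_clinear g \<Longrightarrow> bounded_clinear (\<lambda>x. f (g x))"
  by (simp add: bounded_clinear_iff bounded_linear_compose)

lemma onorm_scaleC:
  assumes f: "bounded_clinear f"
  shows "onorm (\<lambda>x. c *\<^sub>C f x) = cmod c * onorm f"
proof (rule antisym)
  have le: "onorm (\<lambda>x. d *\<^sub>C g x) \<le> cmod d * onorm g" if "bounded_clinear g" for d and g :: "'a \<Rightarrow> 'b"
  proof (rule onorm_bound)
    show "0 \<le> cmod d * onorm g" by (simp add: onorm_pos_le bounded_clinear_bounded_linear that)
    show "norm (d *\<^sub>C g x) \<le> cmod d * onorm g * norm x" for x
      using onorm [OF bounded_clinear_bounded_linear [OF that], of x]
      by (simp add: norm_scaleC mult.assoc mult_left_mono)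
  qed
  show "onorm (\<lambda>x. c *\<^sub>C f x) \<le> cmod c * onorm f" by (rule le [OF f])
  show "cmod c * onorm f \<le> onorm (\<lambda>x. c *\<^sub>C f x)"
  proof (cases "c = 0")
    case True
    then show ?thesis by (simp add: onorm_zero)
  next
    case False
    then have "onorm f \<le> cmod (inverse c) * onorm (\<lambda>x. c *\<^sub>C f x)"
      using le [OF bounded_clinear_scaleC [OF f], of "inverse c" c] by (simp add: scaleC_scaleC scaleC_one)
    then have "onorm f \<le> onorm (\<lambda>x. c *\<^sub>C f x) / cmod c"
      by (simp add: norm_inverse inverse_eq_divide norm_divide)
    then show ?thesis using False by (simp add: field_simps)
  qed
qed

typedef (overloaded) 'a cdual = "{f :: 'a::complex_normed_vector \<Rightarrow> complex. bounded_clinear f}"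
  morphisms cdual_apply CDual
  using bounded_clinear_zero by blast

setup_lifting type_definition_cdual

instantiation cdual :: (complex_normed_vector) complex_normed_vector
begin

lift_definition norm_cdual :: "'a cdual \<Rightarrow> real" is onorm .

lift_definition minus_cdual :: "'a cdual \<Rightarrow> 'a cdual \<Rightarrow> 'a cdual" is "\<lambda>f g x. f x - g x"
  by (rule bounded_clinear_sub)

lift_definition uminus_cdual :: "'a cdual \<Rightarrow> 'a cdual" is "\<lambda>f x. - f x"
  by (rule bounded_clinear_minus)

lift_definition zero_cdual :: "'a cdual" is "\<lambda>x. 0"
  by (rule bounded_clinear_zero)

lift_definition plus_cdual :: "'a cdual \<Rightarrow> 'a cdual \<Rightarrow> 'a cdual" is "\<lambda>f g x. f x + g x"
  by (rule bounded_clinear_add)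

lift_definition scaleC_cdual :: "complex \<Rightarrow> 'a cdual \<Rightarrow> 'a cdual" is "\<lambda>c f x. c *\<^sub>C f x"
  by (rule bounded_clinear_scaleC)

definition scaleR_cdual :: "real \<Rightarrow> 'a cdual \<Rightarrow> 'a cdual"
  where "scaleR_cdual r f = complex_of_real r *\<^sub>C f"

definition dist_cdual :: "'a cdual \<Rightarrow> 'a cdual \<Rightarrow> real"
  where "dist_cdual f g = norm (f - g)"

definition sgn_cdual :: "'a cdual \<Rightarrow> 'a cdual"
  where "sgn_cdual f = inverse (norm f) *\<^sub>R f"

definition uniformity_cdual :: "('a cdual \<times> 'a cdual) filter"
  where "uniformity_cdual = (INF e\<in>{0 <..}. principal {(x, y). dist x y < e})"

definition open_cdual :: "'a cdual set \<Rightarrow> bool"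
  where "open_cdual S = (\<forall>x\<in>S. \<forall>\<^sub>F (x', y) in uniformity. x' = x \<longrightarrow> y \<in> S)"

instance
proof
  fix f g h :: "'a cdual" and a b :: complex and r s :: real
  show "r *\<^sub>R f = complex_of_real r *\<^sub>C f" by (simp add: scaleR_cdual_def)
  show "f + g + h = f + (g + h)" "f + g = g + f" "0 + f = f" "- f + f = 0" "f - g = f + - g"
    by (transfer, simp add: algebra_simps)+
  show "a *\<^sub>C (f + g) = a *\<^sub>C f + a *\<^sub>C g" "(a + b) *\<^sub>C f = a *\<^sub>C f + b *\<^sub>C f"
    "a *\<^sub>C b *\<^sub>C f = (a * b) *\<^sub>C f" "1 *\<^sub>C f = f"
    by (transfer, simp add: scaleC_add_right scaleC_add_left scaleC_scaleC scaleC_one)+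
  show "r *\<^sub>R (f + g) = r *\<^sub>R f + r *\<^sub>R g" "(r + s) *\<^sub>R f = r *\<^sub>R f + s *\<^sub>R f"
    "r *\<^sub>R s *\<^sub>R f = (r * s) *\<^sub>R f" "1 *\<^sub>R f = f"
    unfolding scaleR_cdual_def
    by (transfer, simp add: scaleC_add_right scaleC_add_left scaleC_scaleC scaleC_one)+
  show "dist f g = norm (f - g)" by (simp add: dist_cdual_def)
  show "sgn f = inverse (norm f) *\<^sub>R f" by (simp add: sgn_cdual_def)
  show "uniformity = (INF e\<in>{0 <..}. principal {(x, y::'a cdual). dist x y < e})"
    by (simp add: uniformity_cdual_def)
  show "open S = (\<forall>x\<in>S. \<forall>\<^sub>F (x', y) in uniformity. x' = x \<longrightarrow> y \<in> S)" for S :: "'a cdual set"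
    by (simp add: open_cdual_def)
  show "norm f = 0 \<longleftrightarrow> f = 0"
    by transfer (simp add: onorm_eq_0 bounded_clinear_bounded_linear fun_eq_iff)
  show "norm (f + g) \<le> norm f + norm g"
    by transfer (simp add: onorm_triangle bounded_clinear_bounded_linear)
  show "norm (a *\<^sub>C f) = cmod a * norm f"
    by transfer (rule onorm_scaleC)
  show "norm (r *\<^sub>R f) = \<bar>r\<bar> * norm f"
    unfolding scaleR_cdual_def by transfer (simp add: onorm_scaleC)
qed

end

typedef (overloaded) 'a bop = "{T :: 'a::complex_normed_vector \<Rightarrow> 'a. bounded_clinear T}"
  morphisms bop_apply Bop
  using bounded_clinear_zero by blast

setup_lifting type_definition_bop

instantiation bop :: (complex_normed_vector) complex_normed_algebra
begin

lift_definition norm_bop :: "'a bop \<Rightarrow> real" is onorm .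

lift_definition minus_bop :: "'a bop \<Rightarrow> 'a bop \<Rightarrow> 'a bop" is "\<lambda>S T x. S x - T x"
  by (rule bounded_clinear_sub)

lift_definition uminus_bop :: "'a bop \<Rightarrow> 'a bop" is "\<lambda>T x. - T x"
  by (rule bounded_clinear_minus)

lift_definition zero_bop :: "'a bop" is "\<lambda>x. 0"
  by (rule bounded_clinear_zero)

lift_definition plus_bop :: "'a bop \<Rightarrow> 'a bop \<Rightarrow> 'a bop" is "\<lambda>S T x. S x + T x"
  by (rule bounded_clinear_add)

lift_definition times_bop :: "'a bop \<Rightarrow> 'a bop \<Rightarrow> 'a bop" is "\<lambda>S T x. S (T x)"
  by (rule bounded_clinear_compose)

lift_definition scaleC_bop :: "complex \<Rightarrow> 'a bop \<Rightarrow> 'a bop" is "\<lambda>c T x. c *\<^sub>C T x"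
  by (rule bounded_clinear_scaleC)

definition scaleR_bop :: "real \<Rightarrow> 'a bop \<Rightarrow> 'a bop"
  where "scaleR_bop r T = complex_of_real r *\<^sub>C T"

definition dist_bop :: "'a bop \<Rightarrow> 'a bop \<Rightarrow> real"
  where "dist_bop S T = norm (S - T)"

definition sgn_bop :: "'a bop \<Rightarrow> 'a bop"
  where "sgn_bop T = inverse (norm T) *\<^sub>R T"

definition uniformity_bop :: "('a bop \<times> 'a bop) filter"
  where "uniformity_bop = (INF e\<in>{0 <..}. principal {(x, y). dist x y < e})"

definition open_bop :: "'a bop set \<Rightarrow> bool"
  where "open_bop S = (\<forall>x\<in>S. \<forall>\<^sub>F (x', y) in uniformity. x' = x \<longrightarrow> y \<in> S)"

instance
proof
  fix f g h :: "'a bop" and a b :: complex and r s :: real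
  show R: "r *\<^sub>R f = complex_of_real r *\<^sub>C f" for r and f :: "'a bop" by (simp add: scaleR_bop_def)
  show "f + g + h = f + (g + h)" "f + g = g + f" "0 + f = f" "- f + f = 0" "f - g = f + - g"
    by (transfer, simp add: algebra_simps)+
  show "a *\<^sub>C (f + g) = a *\<^sub>C f + a *\<^sub>C g" "(a + b) *\<^sub>C f = a *\<^sub>C f + b *\<^sub>C f"
    "a *\<^sub>C b *\<^sub>C f = (a * b) *\<^sub>C f" "1 *\<^sub>C f = f"
    by (transfer, simp add: scaleC_add_right scaleC_add_left scaleC_scaleC scaleC_one)+
  show "r *\<^sub>R (f + g) = r *\<^sub>R f + r *\<^sub>R g" "(r + s) *\<^sub>R f = r *\<^sub>R f + s *\<^sub>R f"
    "r *\<^sub>R s *\<^sub>R f = (r * s) *\<^sub>R f" "1 *\<^sub>R f = f"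
    unfolding scaleR_bop_def
    by (transfer, simp add: scaleC_add_right scaleC_add_left scaleC_scaleC scaleC_one)+
  show "dist f g = norm (f - g)" by (simp add: dist_bop_def)
  show "sgn f = inverse (norm f) *\<^sub>R f" by (simp add: sgn_bop_def)
  show "uniformity = (INF e\<in>{0 <..}. principal {(x, y::'a bop). dist x y < e})"
    by (simp add: uniformity_bop_def)
  show "open S = (\<forall>x\<in>S. \<forall>\<^sub>F (x', y) in uniformity. x' = x \<longrightarrow> y \<in> S)" for S :: "'a bop set"
    by (simp add: open_bop_def)
  show "norm f = 0 \<longleftrightarrow> f = 0"
    by transfer (simp add: onorm_eq_0 bounded_clinear_bounded_linear fun_eq_iff)
  show "norm (f + g) \<le> norm f + norm g"
    by transfer (simp add: onorm_triangle bounded_clinear_bounded_linear)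
  show "norm (a *\<^sub>C f) = cmod a * norm f"
    by transfer (rule onorm_scaleC)
  show "norm (r *\<^sub>R f) = \<bar>r\<bar> * norm f"
    unfolding scaleR_bop_def by transfer (simp add: onorm_scaleC)
  show "f * g * h = f * (g * h)" "(f + g) * h = f * h + g * h"
    by (transfer, simp)+
  show "f * (g + h) = f * g + f * h"
    by transfer (simp add: clinear_add bounded_clinearD)
  show m1: "(a *\<^sub>C f) * g = a *\<^sub>C (f * g)" for a f and g :: "'a bop"
    by transfer simp
  show m2: "f * (a *\<^sub>C g) = a *\<^sub>C (f * g)" for a f and g :: "'a bop"
    by transfer (simp add: clinear_scale bounded_clinearD)
  show "r *\<^sub>R f * g = r *\<^sub>R (f * g)" "f * r *\<^sub>R g = r *\<^sub>R (f * g)"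
    by (simp_all only: R m1 m2)
  show "norm (f * g) \<le> norm f * norm g"
    by transfer (simp add: onorm_compose [unfolded o_def] bounded_clinear_bounded_linear)
qed

end

lemma clinear_limit_Blinfun:
  fixes T :: "nat \<Rightarrow> 'a::complex_normed_vector \<Rightarrow> 'b::complex_normed_vector"
  assumes T: "\<And>n. bounded_clinear (T n)" and lim: "(\<lambda>n. Blinfun (T n)) \<longlonglongrightarrow> L"
  shows "bounded_clinear (blinfun_apply L)" "(\<lambda>n. T n x) \<longlonglongrightarrow> blinfun_apply L x"
proof -
  have ap: "blinfun_apply (Blinfun (T n)) = T n" for n
    by (simp add: bounded_linear_Blinfun_apply bounded_clinear_bounded_linear T)
  show l: "(\<lambda>n. T n x) \<longlonglongrightarrow> blinfun_apply L x" for x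
    using blinfun.tendsto [OF lim tendsto_const, of x] by (simp add: ap)
  have "blinfun_apply L (c *\<^sub>C x) = c *\<^sub>C blinfun_apply L x" for c x
  proof (rule LIMSEQ_unique)
    show "(\<lambda>n. T n (c *\<^sub>C x)) \<longlonglongrightarrow> blinfun_apply L (c *\<^sub>C x)" by (rule l)
    have "bounded_linear (\<lambda>y::'b. c *\<^sub>C y)"
      using bounded_clinear_scaleC [OF bounded_clinear_ident] by (rule bounded_clinear_bounded_linear)
    from bounded_linear.tendsto [OF this l]
    show "(\<lambda>n. T n (c *\<^sub>C x)) \<longlonglongrightarrow> c *\<^sub>C blinfun_apply L x"
      by (simp add: clinear_scale [OF bounded_clinearD [OF T]])
  qed
  then show "bounded_clinear (blinfun_apply L)"
    by (simp add: bounded_clinear_iff blinfun.bounded_linear_right)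
qed

class complex_banach = complex_normed_vector + complete_space
begin

subclass banach ..

end

subclass (in chilbert_space) complex_banach ..

instance bop :: (complex_banach) complex_banach_algebra
proof
  fix X :: "nat \<Rightarrow> 'a bop" assume X: "Cauchy X"
  let ?B = "\<lambda>T::'a bop. Blinfun (bop_apply T)"
  have bc: "bounded_clinear (bop_apply T)" for T :: "'a bop" using bop_apply by blast
  have ap: "blinfun_apply (?B T) = bop_apply T" for T :: "'a bop"
    by (simp add: bounded_linear_Blinfun_apply bounded_clinear_bounded_linear bc)
  have nB: "norm (?B S - ?B T) = norm (S - T)" for S T :: "'a bop"
    by (simp add: norm_blinfun.rep_eq norm_bop.rep_eq minus_blinfun.rep_eq minus_bop.rep_eq ap)
  have "Cauchy (\<lambda>n. ?B (X n))"
    using X by (simp add: Cauchy_def dist_norm nB)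
  then obtain L where L: "(\<lambda>n. ?B (X n)) \<longlonglongrightarrow> L"
    using Cauchy_convergent_iff convergent_def by blast
  have "bounded_clinear (blinfun_apply L)" by (rule clinear_limit_Blinfun [OF bc L])
  then have "L = ?B (Bop (blinfun_apply L))"
    by (simp add: Bop_inverse blinfun_apply_inverse)
  then have "X \<longlonglongrightarrow> Bop (blinfun_apply L)"
    using L unfolding tendsto_iff dist_norm by (metis (no_types, lifting) nB eventually_mono)
  then show "convergent X" by (rule convergentI)
qed

section \<open>Orthonormal bases, adjoints and trace\<close>

lemma tendsto_scaleC:
  assumes "f \<longlonglongrightarrow> (l::'a::complex_normed_vector)"
  shows "(\<lambda>n. c *\<^sub>C f n) \<longlonglongrightarrow> c *\<^sub>C l"
  using bounded_linear.tendsto [OF bounded_clinear_bounded_linear [OF bounded_clinear_scaleC [OF bounded_clinear_ident]] assms] .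

lemma closure_subspace:
  assumes S: "complex_vector.subspace (S :: 'a::complex_normed_vector set)"
  shows "complex_vector.subspace (closure S)"
proof (rule complex_vector.subspaceI)
  show "0 \<in> closure S" using complex_vector.subspace_0 [OF S] closure_subset by blast
  fix x y c assume "x \<in> closure S"
  then obtain f where f: "\<And>n. f n \<in> S" "f \<longlonglongrightarrow> x" unfolding closure_sequential by blast
  show "c *\<^sub>C x \<in> closure S"
    unfolding closure_sequential
    using complex_vector.subspace_scale [OF S f(1)] tendsto_scaleC [OF f(2)]
    by (intro CollectI exI [of _ "\<lambda>n. c *\<^sub>C f n"]) simp
  assume "y \<in> closure S"
  then obtain g where g: "\<And>n. g n \<in> S" "g \<longlonglongrightarrow> y" unfolding closure_sequential by blast
  show "x + y \<in> closure S"
    unfolding closure_sequential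
    using complex_vector.subspace_add [OF S f(1) g(1)] tendsto_add [OF f(2) g(2)]
    by (intro CollectI exI [of _ "\<lambda>n. f n + g n"]) simp
qed

definition orthonormal :: "'a::complex_inner set \<Rightarrow> bool"
  where "orthonormal B \<longleftrightarrow> (\<forall>x\<in>B. norm x = 1) \<and> (\<forall>x\<in>B. \<forall>y\<in>B. x \<noteq> y \<longrightarrow> cinner x y = 0)"

definition is_onb :: "'a::complex_inner set \<Rightarrow> bool"
  where "is_onb B \<longleftrightarrow> orthonormal B \<and> closure (complex_vector.span B) = UNIV"

theorem ex_onb: "\<exists>B :: 'a::chilbert_space set. is_onb B"
proof -
  have "\<exists>M\<in>Collect orthonormal. \<forall>X\<in>Collect orthonormal. M \<subseteq> X \<longrightarrow> X = (M :: 'a set)"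
  proof (rule subset_Zorn)
    fix C :: "'a set set" assume C: "subset.chain (Collect orthonormal) C"
    have "\<exists>X\<in>C. x \<in> X \<and> y \<in> X" if xy: "x \<in> \<Union>C" "y \<in> \<Union>C" for x y
    proof -
      obtain X Y where "X \<in> C" "Y \<in> C" "x \<in> X" "y \<in> Y" using xy by blast
      moreover from this have "X \<subseteq> Y \<or> Y \<subseteq> X"
        using C unfolding subset_chain_def by blast
      ultimately show ?thesis by blast
    qed
    moreover have "orthonormal X" if "X \<in> C" for X
      using C that unfolding subset_chain_def by blast
    ultimately have "orthonormal (\<Union>C)" unfolding orthonormal_def by (meson UnionE)
    then show "\<exists>U\<in>Collect orthonormal. \<forall>X\<in>C. X \<subseteq> U" by blast
  qed
  then obtain M :: "'a set" where M: "orthonormal M" and max: "\<And>X. orthonormal X \<Longrightarrow> M \<subseteq> X \<Longrightarrow> X = M"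
    by blast
  have "closure (complex_vector.span M) = UNIV"
  proof (rule ccontr)
    assume ne: "closure (complex_vector.span M) \<noteq> UNIV"
    obtain y where y0: "y \<noteq> 0" and y: "\<And>v. v \<in> closure (complex_vector.span M) \<Longrightarrow> cinner y v = 0"
      using exists_orthogonal [OF closure_subspace [OF complex_vector.subspace_span] closed_closure ne] by blast
    define z where "z = complex_of_real (1 / norm y) *\<^sub>C y"
    have z1: "norm z = 1" using y0 by (simp add: z_def norm_scaleC norm_divide)
    have zv: "cinner z v = 0" "cinner v z = 0" if "v \<in> M" for v
    proof -
      have "v \<in> closure (complex_vector.span M)"
        using that complex_vector.span_base closure_subset by blast
      then show "cinner z v = 0" by (simp add: z_def cinner_scaleC_left y)
      then show "cinner v z = 0" by (subst cinner_commute) simp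
    qed
    have "orthonormal (insert z M)"
      using M z1 zv unfolding orthonormal_def by auto
    then have "z \<in> M" using max by blast
    then have "cinner z z = 0" using zv by blast
    then show False using z1 by (simp add: cinner_self)
  qed
  with M show ?thesis unfolding is_onb_def by blast
qed

text \<open>One orthonormal basis is fixed once and for all.  Whether an operator is Hilbert--Schmidt and
  what its Hilbert--Schmidt norm is do not depend on this choice: see \<open>square_summable_onb\<close> below.\<close>

definition some_onb :: "'a::chilbert_space set"
  where "some_onb = (SOME B. is_onb B)"

lemma is_onb_some_onb: "is_onb some_onb"
  unfolding some_onb_def using ex_onb by (rule someI_ex)

definition ctrace :: "('a::chilbert_space \<Rightarrow> 'a) \<Rightarrow> complex"
  where "ctrace T = (\<Sum>\<^sub>\<infinity>e\<in>some_onb. cinner (T e) e)"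

definition cadjoint :: "('a::chilbert_space \<Rightarrow> 'a) \<Rightarrow> 'a \<Rightarrow> 'a"
  where "cadjoint T = (THE S. \<forall>x y. cinner (T x) y = cinner x (S y))"

theorem riesz_representation:
  fixes f :: "'a::chilbert_space \<Rightarrow> complex"
  assumes f: "bounded_clinear f"
  shows "\<exists>y. \<forall>x. f x = cinner x y"
proof (cases "\<forall>x. f x = 0")
  case True
  then show ?thesis by (intro exI [of _ 0]) simp
next
  case False
  note lin = bounded_clinearD [OF f]
  let ?K = "f -` {0}"
  have sub: "complex_vector.subspace ?K"
    by (rule complex_vector.subspaceI) (simp_all add: clinear_0 [OF lin] clinear_add [OF lin] clinear_scale [OF lin])
  have cl: "closed ?K"
    using bounded_clinear_bounded_linear [OF f]
    by (intro continuous_closed_vimage) (auto intro: linear_continuous_at)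
  have ne: "?K \<noteq> UNIV" using False by auto
  obtain y where y0: "y \<noteq> 0" and y: "\<And>v. v \<in> ?K \<Longrightarrow> cinner y v = 0"
    using exists_orthogonal [OF sub cl ne] by blast
  have yy: "cinner y y \<noteq> 0" using y0 by (simp add: cinner_eq_zero_iff)
  then have fy: "f y \<noteq> 0" using y by auto
  have "f x = cinner x (cnj (f y / cinner y y) *\<^sub>C y)" for x
  proof -
    have "x - (f x / f y) *\<^sub>C y \<in> ?K"
      using fy by (simp add: clinear_diff [OF lin] clinear_scale [OF lin] scaleC_complex_def)
    then have "cinner y (x - (f x / f y) *\<^sub>C y) = 0" by (rule y)
    then have "cinner (x - (f x / f y) *\<^sub>C y) y = 0" by (subst cinner_commute) simp
    then have "cinner x y = f x / f y * cinner y y" by (simp add: cinner_diff_left cinner_scaleC_left)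
    then show ?thesis using fy yy by (simp add: cinner_scaleC_right)
  qed
  then show ?thesis by blast
qed

lemma cinner_ext:
  assumes "\<And>x. cinner x y = cinner x (z::'a::complex_inner)"
  shows "y = z"
proof -
  have "cinner (y - z) (y - z) = 0" using assms by (simp add: cinner_diff_right)
  then show ?thesis by (simp add: cinner_eq_zero_iff)
qed

lemma cadjoint:
  assumes T: "bounded_clinear T"
  shows "cinner (T x) y = cinner x (cadjoint T y)"
proof -
  have "\<exists>z. \<forall>x. cinner (T x) y = cinner x z" for y
  proof (rule riesz_representation)
    obtain K where K: "\<And>x. norm (T x) \<le> K * norm x" using T by (auto simp: bounded_clinear_def)
    show "bounded_clinear (\<lambda>x. cinner (T x) y)"
    proof (rule bounded_clinearI)
      show "norm (cinner (T x) y) \<le> (K * norm y) * norm x" for x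
        using order_trans [OF cinner_Cauchy_Schwarz [of "T x" y] mult_right_mono [OF K [of x] norm_ge_zero [of y]]]
        by (simp add: ac_simps)
    qed (simp_all add: clinear_add [OF bounded_clinearD [OF T]] clinear_scale [OF bounded_clinearD [OF T]]
        cinner_add_left cinner_scaleC_left scaleC_complex_def)
  qed
  then obtain S where S: "\<forall>x y. cinner (T x) y = cinner x (S y)" by metis
  have "\<forall>x y. cinner (T x) y = cinner x (cadjoint T y)"
    unfolding cadjoint_def
  proof (rule theI [where P = "\<lambda>S. \<forall>x y. cinner (T x) y = cinner x (S y)"])
    show "\<forall>x y. cinner (T x) y = cinner x (S y)" by (rule S)
    show "S' = S" if "\<forall>x y. cinner (T x) y = cinner x (S' y)" for S'
      using that S by (intro ext cinner_ext) metis
  qed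
  then show ?thesis by blast
qed

lemma orthonormal_norm_sum:
  assumes F: "finite F" and o: "orthonormal F"
  shows "(norm (\<Sum>v\<in>F. u v *\<^sub>C v))\<^sup>2 = (\<Sum>v\<in>F. (cmod (u v))\<^sup>2)"
  using F o
proof (induction F)
  case (insert v F)
  have o: "orthonormal F" "norm v = 1" "\<And>w. w \<in> F \<Longrightarrow> cinner v w = 0"
    using insert.prems insert.hyps(2) unfolding orthonormal_def by auto
  have "cinner (u v *\<^sub>C v) (\<Sum>w\<in>F. u w *\<^sub>C w) = (\<Sum>w\<in>F. cinner (u v *\<^sub>C v) (u w *\<^sub>C w))"
    using bounded_bilinear.sum_right [OF bounded_bilinear_cinner] by metis
  also have "\<dots> = 0" by (rule sum.neutral) (simp add: cinner_scaleC_left cinner_scaleC_right o)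
  finally show ?case
    using insert.IH [OF o(1)] insert.hyps by (simp add: norm_add_square norm_scaleC o)
qed simp

lemma norm_diff_sum_orthonormal:
  assumes F: "finite F" and o: "orthonormal F"
  shows "(norm (x - (\<Sum>v\<in>F. u v *\<^sub>C v)))\<^sup>2
    = (norm x)\<^sup>2 - (\<Sum>v\<in>F. (cmod (cinner x v))\<^sup>2) + (\<Sum>v\<in>F. (cmod (cinner x v - u v))\<^sup>2)"
proof -
  have c: "cinner x (\<Sum>v\<in>F. u v *\<^sub>C v) = (\<Sum>v\<in>F. cnj (u v) * cinner x v)"
    by (simp add: bounded_bilinear.sum_right [OF bounded_bilinear_cinner] cinner_scaleC_right)
  have p: "(cmod (a - b))\<^sup>2 = (cmod a)\<^sup>2 + (cmod b)\<^sup>2 - 2 * Re (cnj b * a)" for a b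
    unfolding cmod_power2 by (simp add: power2_eq_square algebra_simps)
  have "(norm (x - (\<Sum>v\<in>F. u v *\<^sub>C v)))\<^sup>2
    = (norm x)\<^sup>2 + (\<Sum>v\<in>F. (cmod (u v))\<^sup>2) - 2 * Re (\<Sum>v\<in>F. cnj (u v) * cinner x v)"
    using norm_add_square [of x "- (\<Sum>v\<in>F. u v *\<^sub>C v)"]
    by (simp add: cinner_minus_right c orthonormal_norm_sum [OF F o])
  also have "\<dots> = (norm x)\<^sup>2 - (\<Sum>v\<in>F. (cmod (cinner x v))\<^sup>2) + (\<Sum>v\<in>F. (cmod (cinner x v - u v))\<^sup>2)"
    by (simp add: p sum.distrib sum_subtractf sum_distrib_left)
  finally show ?thesis .
qed

lemma orthonormal_subset: "orthonormal B \<Longrightarrow> F \<subseteq> B \<Longrightarrow> orthonormal F"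
  unfolding orthonormal_def by (meson subsetD)

lemma bessel:
  assumes "finite F" "orthonormal F"
  shows "(\<Sum>v\<in>F. (cmod (cinner x v))\<^sup>2) \<le> (norm x)\<^sup>2"
  using norm_diff_sum_orthonormal [OF assms, of x "\<lambda>v. cinner x v"] zero_le_power2 by (simp, smt (verit) zero_le_power2)

lemma parseval:
  assumes B: "is_onb B"
  shows "((\<lambda>e. (cmod (cinner x e))\<^sup>2) has_sum (norm x)\<^sup>2) B"
proof -
  have o: "orthonormal F" if "F \<subseteq> B" for F
    using orthonormal_subset [OF _ that] B by (simp add: is_onb_def)
  have sm: "(\<lambda>e. (cmod (cinner x e))\<^sup>2) summable_on B"
    by (rule nonneg_bdd_above_summable_on) (auto intro!: bdd_aboveI2 bessel o)
  have le: "(\<Sum>\<^sub>\<infinity>e\<in>B. (cmod (cinner x e))\<^sup>2) \<le> (norm x)\<^sup>2"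
    by (rule infsum_le_finite_sums [OF sm]) (simp add: bessel o)
  have "(norm x)\<^sup>2 \<le> (\<Sum>\<^sub>\<infinity>e\<in>B. (cmod (cinner x e))\<^sup>2)"
  proof (rule field_le_epsilon)
    fix d :: real assume d: "d > 0"
    have "x \<in> closure (complex_vector.span B)" using B by (simp add: is_onb_def)
    then obtain y where y: "y \<in> complex_vector.span B" "dist y x < sqrt d"
      using d unfolding closure_approachable by (meson real_sqrt_gt_zero)
    obtain F u where F: "finite F" "F \<subseteq> B" and yF: "y = (\<Sum>v\<in>F. u v *\<^sub>C v)"
      using y(1) unfolding complex_vector.span_explicit by blast
    have "norm (x - y) \<le> sqrt d" using y(2) by (simp add: dist_norm norm_minus_commute)
    then have "(norm (x - y))\<^sup>2 \<le> d" using d by (metis norm_ge_zero power_mono real_sqrt_pow2 less_imp_le)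
    then have "(norm x)\<^sup>2 - (\<Sum>v\<in>F. (cmod (cinner x v))\<^sup>2) + (\<Sum>v\<in>F. (cmod (cinner x v - u v))\<^sup>2) \<le> d"
      unfolding yF norm_diff_sum_orthonormal [OF F(1) o [OF F(2)]] .
    moreover have "0 \<le> (\<Sum>v\<in>F. (cmod (cinner x v - u v))\<^sup>2)" by (rule sum_nonneg) simp
    moreover have "(\<Sum>v\<in>F. (cmod (cinner x v))\<^sup>2) \<le> (\<Sum>\<^sub>\<infinity>e\<in>B. (cmod (cinner x e))\<^sup>2)"
      by (rule finite_sum_le_infsum [OF sm F]) simp
    ultimately show "(norm x)\<^sup>2 \<le> (\<Sum>\<^sub>\<infinity>e\<in>B. (cmod (cinner x e))\<^sup>2) + d" by linarith
  qed
  with le sm show ?thesis using has_sum_infsum by fastforce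
qed

lemma adjoint_square_summable:
  assumes adj: "\<And>x y. cinner (T x) y = cinner x (S y)" and B: "is_onb B" and C: "is_onb C"
    and T: "(\<lambda>e. (norm (T e))\<^sup>2) summable_on B"
  shows "(\<lambda>e. (norm (S e))\<^sup>2) summable_on C"
    and "(\<Sum>\<^sub>\<infinity>e\<in>C. (norm (S e))\<^sup>2) \<le> (\<Sum>\<^sub>\<infinity>e\<in>B. (norm (T e))\<^sup>2)"
proof -
  have le: "(\<Sum>f\<in>F. (norm (S f))\<^sup>2) \<le> (\<Sum>\<^sub>\<infinity>e\<in>B. (norm (T e))\<^sup>2)" if F: "finite F" "F \<subseteq> C" for F
  proof -
    have o: "orthonormal F" using C orthonormal_subset [OF _ F(2)] by (simp add: is_onb_def)
    have "cmod (cinner (S f) e) = cmod (cinner (T e) f)" for e f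
      unfolding adj by (subst cinner_commute) simp
    then have p: "((\<lambda>e. (cmod (cinner (T e) f))\<^sup>2) has_sum (norm (S f))\<^sup>2) B" for f
      using parseval [OF B, of "S f"] by simp
    have "((\<lambda>e. \<Sum>f\<in>F. (cmod (cinner (T e) f))\<^sup>2) has_sum (\<Sum>f\<in>F. (norm (S f))\<^sup>2)) B"
      using F(1) by (induction F) (auto intro: has_sum_add p)
    then show ?thesis
      by (rule has_sum_mono [OF _ has_sum_infsum [OF T]]) (simp add: bessel F o)
  qed
  show sm: "(\<lambda>e. (norm (S e))\<^sup>2) summable_on C"
    by (rule nonneg_bdd_above_summable_on) (auto intro!: bdd_aboveI2 le)
  show "(\<Sum>\<^sub>\<infinity>e\<in>C. (norm (S e))\<^sup>2) \<le> (\<Sum>\<^sub>\<infinity>e\<in>B. (norm (T e))\<^sup>2)"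
    by (rule infsum_le_finite_sums [OF sm]) (simp add: le)
qed

theorem square_summable_onb:
  fixes T :: "'a::chilbert_space \<Rightarrow> 'a"
  assumes T: "bounded_clinear T" and B: "is_onb B" and C: "is_onb C"
    and sm: "(\<lambda>e. (norm (T e))\<^sup>2) summable_on B"
  shows "(\<lambda>e. (norm (T e))\<^sup>2) summable_on C"
    and "(\<Sum>\<^sub>\<infinity>e\<in>C. (norm (T e))\<^sup>2) = (\<Sum>\<^sub>\<infinity>e\<in>B. (norm (T e))\<^sup>2)"
proof -
  have adj: "cinner (T x) y = cinner x (cadjoint T y)" for x y by (rule cadjoint [OF T])
  then have adj': "cinner (cadjoint T x) y = cinner x (T y)" for x y by (metis cinner_commute)
  note S = adjoint_square_summable [OF adj B B sm]
  show sm': "(\<lambda>e. (norm (T e))\<^sup>2) summable_on C"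
    by (rule adjoint_square_summable(1) [OF adj' B C S(1)])
  note S' = adjoint_square_summable [OF adj C C sm']
  show "(\<Sum>\<^sub>\<infinity>e\<in>C. (norm (T e))\<^sup>2) = (\<Sum>\<^sub>\<infinity>e\<in>B. (norm (T e))\<^sup>2)"
    using adjoint_square_summable(2) [OF adj' B C S(1)] S(2)
      adjoint_square_summable(2) [OF adj' C B S'(1)] S'(2) by linarith
qed

section \<open>Hilbert--Schmidt operators\<close>

definition hilbert_schmidt :: "('a::chilbert_space \<Rightarrow> 'a) \<Rightarrow> bool"
  where "hilbert_schmidt T \<longleftrightarrow> bounded_clinear T \<and> (\<lambda>e. (norm (T e))\<^sup>2) summable_on some_onb"

lemma hilbert_schmidt_bounded: "hilbert_schmidt T \<Longrightarrow> bounded_clinear T"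
  by (simp add: hilbert_schmidt_def)

lemma hilbert_schmidt_add:
  assumes S: "hilbert_schmidt S" and T: "hilbert_schmidt T"
  shows "hilbert_schmidt (\<lambda>x. S x + T x)"
  unfolding hilbert_schmidt_def
proof
  show "bounded_clinear (\<lambda>x. S x + T x)"
    using S T by (simp add: bounded_clinear_add hilbert_schmidt_def)
  show "(\<lambda>e. (norm (S e + T e))\<^sup>2) summable_on some_onb"
  proof (rule summable_on_comparison_test)
    show "(\<lambda>e. 2 * (norm (S e))\<^sup>2 + 2 * (norm (T e))\<^sup>2) summable_on some_onb"
      using S T by (intro summable_on_add summable_on_cmult_right) (auto simp: hilbert_schmidt_def)
    show "(norm (S e + T e))\<^sup>2 \<le> 2 * (norm (S e))\<^sup>2 + 2 * (norm (T e))\<^sup>2" for e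
      using parallelogram [of "S e" "T e"] zero_le_power2 [of "norm (S e - T e)"] by linarith
  qed simp
qed

lemma hilbert_schmidt_compose_left:
  assumes S: "bounded_clinear S" and T: "hilbert_schmidt T"
  shows "hilbert_schmidt (\<lambda>x. S (T x))"
  unfolding hilbert_schmidt_def
proof
  show "bounded_clinear (\<lambda>x. S (T x))"
    using S T by (simp add: bounded_clinear_compose hilbert_schmidt_def)
  show "(\<lambda>e. (norm (S (T e)))\<^sup>2) summable_on some_onb"
  proof (rule summable_on_comparison_test)
    show "(\<lambda>e. (onorm S)\<^sup>2 * (norm (T e))\<^sup>2) summable_on some_onb"
      using T by (intro summable_on_cmult_right) (auto simp: hilbert_schmidt_def)
    show "(norm (S (T e)))\<^sup>2 \<le> (onorm S)\<^sup>2 * (norm (T e))\<^sup>2" for e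
      using onorm [OF bounded_clinear_bounded_linear [OF S], of "T e"]
      by (metis norm_ge_zero power_mono power_mult_distrib)
  qed simp
qed

lemma hilbert_schmidt_scaleC: "hilbert_schmidt T \<Longrightarrow> hilbert_schmidt (\<lambda>x. c *\<^sub>C T x)"
  using hilbert_schmidt_compose_left [OF bounded_clinear_scaleC [OF bounded_clinear_ident]] .

lemma hilbert_schmidt_minus: "hilbert_schmidt T \<Longrightarrow> hilbert_schmidt (\<lambda>x. - T x)"
  using hilbert_schmidt_compose_left [OF bounded_clinear_minus [OF bounded_clinear_ident]] .

lemma hilbert_schmidt_diff: "hilbert_schmidt S \<Longrightarrow> hilbert_schmidt T \<Longrightarrow> hilbert_schmidt (\<lambda>x. S x - T x)"
  using hilbert_schmidt_add [OF _ hilbert_schmidt_minus, of S T] by simp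

lemma hilbert_schmidt_zero: "hilbert_schmidt (\<lambda>x. 0)"
  by (simp add: hilbert_schmidt_def bounded_clinear_zero)

typedef (overloaded) 'a hs = "{T :: 'a::chilbert_space \<Rightarrow> 'a. hilbert_schmidt T}"
  morphisms hs_apply HS
  using hilbert_schmidt_zero by blast

setup_lifting type_definition_hs

lemma hilbert_schmidt_hs_apply: "hilbert_schmidt (hs_apply T)"
  using hs_apply by blast

instantiation hs :: (chilbert_space) complex_vector
begin

lift_definition minus_hs :: "'a hs \<Rightarrow> 'a hs \<Rightarrow> 'a hs" is "\<lambda>S T x. S x - T x"
  by (rule hilbert_schmidt_diff)

lift_definition uminus_hs :: "'a hs \<Rightarrow> 'a hs" is "\<lambda>T x. - T x"
  by (rule hilbert_schmidt_minus)

lift_definition zero_hs :: "'a hs" is "\<lambda>x. 0"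
  by (rule hilbert_schmidt_zero)

lift_definition plus_hs :: "'a hs \<Rightarrow> 'a hs \<Rightarrow> 'a hs" is "\<lambda>S T x. S x + T x"
  by (rule hilbert_schmidt_add)

lift_definition scaleC_hs :: "complex \<Rightarrow> 'a hs \<Rightarrow> 'a hs" is "\<lambda>c T x. c *\<^sub>C T x"
  by (rule hilbert_schmidt_scaleC)

definition scaleR_hs :: "real \<Rightarrow> 'a hs \<Rightarrow> 'a hs"
  where "scaleR_hs r T = complex_of_real r *\<^sub>C T"

instance
proof
  fix f g h :: "'a hs" and a b :: complex and r s :: real
  show "r *\<^sub>R f = complex_of_real r *\<^sub>C f" by (simp add: scaleR_hs_def)
  show "f + g + h = f + (g + h)" "f + g = g + f" "0 + f = f" "- f + f = 0" "f - g = f + - g"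
    by (transfer, simp add: algebra_simps)+
  show "a *\<^sub>C (f + g) = a *\<^sub>C f + a *\<^sub>C g" "(a + b) *\<^sub>C f = a *\<^sub>C f + b *\<^sub>C f"
    "a *\<^sub>C b *\<^sub>C f = (a * b) *\<^sub>C f" "1 *\<^sub>C f = f"
    by (transfer, simp add: scaleC_add_right scaleC_add_left scaleC_scaleC scaleC_one)+
qed

end

lemma summable_cinner_hs:
  fixes S T :: "'a::chilbert_space \<Rightarrow> 'a"
  assumes S: "hilbert_schmidt S" and T: "hilbert_schmidt T"
  shows "(\<lambda>e. cinner (S e) (T e)) summable_on some_onb"
proof (rule abs_summable_summable)
  show "(\<lambda>e. norm (cinner (S e) (T e))) summable_on some_onb"
  proof (rule summable_on_comparison_test)
    show "(\<lambda>e. (norm (S e))\<^sup>2 + (norm (T e))\<^sup>2) summable_on some_onb"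
      using S T by (intro summable_on_add) (auto simp: hilbert_schmidt_def)
    show "norm (cinner (S e) (T e)) \<le> (norm (S e))\<^sup>2 + (norm (T e))\<^sup>2" for e
      using cinner_Cauchy_Schwarz [of "S e" "T e"] sum_squares_bound [of "norm (S e)" "norm (T e)"]
        mult_nonneg_nonneg [OF norm_ge_zero norm_ge_zero, of "S e" "T e"]
      by linarith
  qed simp
qed

lemma clinear_eq_0_on_onb:
  fixes T :: "'a::chilbert_space \<Rightarrow> 'a"
  assumes T: "bounded_clinear T" and 0: "\<And>e. e \<in> some_onb \<Longrightarrow> T e = 0"
  shows "T x = 0"
proof -
  note lin = bounded_clinearD [OF T]
  have sub: "complex_vector.subspace (T -` {0})"
    by (rule complex_vector.subspaceI) (simp_all add: clinear_0 [OF lin] clinear_add [OF lin] clinear_scale [OF lin])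
  have cl: "closed (T -` {0})"
    using bounded_clinear_bounded_linear [OF T]
    by (intro continuous_closed_vimage) (auto intro: linear_continuous_at)
  have "complex_vector.span some_onb \<subseteq> T -` {0}"
    using 0 by (intro complex_vector.span_minimal sub) auto
  then have "closure (complex_vector.span some_onb) \<subseteq> T -` {0}"
    using cl by (rule closure_minimal)
  then show ?thesis using is_onb_some_onb [where 'a = 'a] unfolding is_onb_def by blast
qed

instantiation hs :: (chilbert_space) complex_inner_space
begin

lift_definition cinner_hs :: "'a hs \<Rightarrow> 'a hs \<Rightarrow> complex"
  is "\<lambda>S T. ctrace (\<lambda>x. cadjoint T (S x))" .

lemma cinner_hs_eq: "cinner S T = (\<Sum>\<^sub>\<infinity>e\<in>some_onb. cinner (hs_apply S e) (hs_apply T e))"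
proof transfer
  fix S T :: "'a \<Rightarrow> 'a" assume "hilbert_schmidt T"
  then have "cinner (cadjoint T x) y = cinner x (T y)" for x y
    by (metis cadjoint cinner_commute hilbert_schmidt_bounded)
  then show "ctrace (\<lambda>x. cadjoint T (S x)) = (\<Sum>\<^sub>\<infinity>e\<in>some_onb. cinner (S e) (T e))"
    by (simp add: ctrace_def)
qed

lemma cinner_hs_self: "cinner T T = complex_of_real (\<Sum>\<^sub>\<infinity>e\<in>some_onb. (norm (hs_apply T e))\<^sup>2)"
proof -
  have "(\<lambda>e. (norm (hs_apply T e))\<^sup>2) summable_on some_onb"
    using hilbert_schmidt_hs_apply [of T] by (simp add: hilbert_schmidt_def)
  then have "((\<lambda>e. complex_of_real ((norm (hs_apply T e))\<^sup>2)) has_sum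
      complex_of_real (\<Sum>\<^sub>\<infinity>e\<in>some_onb. (norm (hs_apply T e))\<^sup>2)) some_onb"
    by (simp only: has_sum_of_real_iff has_sum_infsum)
  then show ?thesis unfolding cinner_hs_eq cinner_self by (rule infsumI)
qed

instance
proof
  fix S T U :: "'a hs" and a :: complex
  note sm = summable_cinner_hs [OF hilbert_schmidt_hs_apply hilbert_schmidt_hs_apply]
  show "cinner S T = cnj (cinner T S)"
    unfolding cinner_hs_eq infsum_cnj [symmetric]
    by (rule infsum_cong) (rule cinner_commute)
  show "cinner (S + T) U = cinner S U + cinner T U"
    unfolding cinner_hs_eq plus_hs.rep_eq cinner_add_left by (rule infsum_add) (rule sm)+
  show "cinner (a *\<^sub>C S) T = a * cinner S T"
    unfolding cinner_hs_eq scaleC_hs.rep_eq cinner_scaleC_left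
    by (rule infsum_cmult_right) (rule sm)
  show "0 \<le> Re (cinner S S)"
    unfolding cinner_hs_self by (simp add: infsum_nonneg)
  show "cinner S S = 0 \<longleftrightarrow> S = 0"
  proof
    assume "cinner S S = 0"
    then have "(\<Sum>\<^sub>\<infinity>e\<in>some_onb. (norm (hs_apply S e))\<^sup>2) = 0" unfolding cinner_hs_self by simp
    then have "(norm (hs_apply S e))\<^sup>2 = 0" if "e \<in> some_onb" for e
      using that hilbert_schmidt_hs_apply [of S]
      by (intro nonneg_infsum_le_0D [where A = some_onb]) (auto simp: hilbert_schmidt_def)
    then have "hs_apply S e = 0" if "e \<in> some_onb" for e
      using that by simp
    then have "hs_apply S x = 0" for x
      by (rule clinear_eq_0_on_onb [OF hilbert_schmidt_bounded [OF hilbert_schmidt_hs_apply]])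
    then show "S = 0" by transfer auto
  next
    show "S = 0 \<Longrightarrow> cinner S S = 0" unfolding cinner_hs_self by (simp add: zero_hs.rep_eq)
  qed
qed

end

instantiation hs :: (chilbert_space) complex_inner
begin

definition norm_hs :: "'a hs \<Rightarrow> real"
  where "norm_hs T = sqrt (Re (cinner T T))"

definition dist_hs :: "'a hs \<Rightarrow> 'a hs \<Rightarrow> real"
  where "dist_hs S T = norm (S - T)"

definition sgn_hs :: "'a hs \<Rightarrow> 'a hs"
  where "sgn_hs T = inverse (norm T) *\<^sub>R T"

definition uniformity_hs :: "('a hs \<times> 'a hs) filter"
  where "uniformity_hs = (INF e\<in>{0 <..}. principal {(x, y). dist x y < e})"

definition open_hs :: "'a hs set \<Rightarrow> bool"
  where "open_hs S = (\<forall>x\<in>S. \<forall>\<^sub>F (x', y) in uniformity. x' = x \<longrightarrow> y \<in> S)"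

instance
proof
  fix S T :: "'a hs" and a :: complex and r :: real
  have n: "norm T = inorm T" for T :: "'a hs" by (simp add: norm_hs_def inorm_def)
  show "dist S T = norm (S - T)" by (simp add: dist_hs_def)
  show "sgn S = inverse (norm S) *\<^sub>R S" by (simp add: sgn_hs_def)
  show "uniformity = (INF e\<in>{0 <..}. principal {(x, y::'a hs). dist x y < e})"
    by (simp add: uniformity_hs_def)
  show "open A = (\<forall>x\<in>A. \<forall>\<^sub>F (x', y) in uniformity. x' = x \<longrightarrow> y \<in> A)" for A :: "'a hs set"
    by (simp add: open_hs_def)
  show "norm S = 0 \<longleftrightarrow> S = 0" by (simp add: n inorm_eq_zero)
  show "norm (S + T) \<le> norm S + norm T" by (simp add: n inorm_triangle)
  show "norm (a *\<^sub>C S) = cmod a * norm S" by (simp add: n inorm_scaleC)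
  show "norm (r *\<^sub>R S) = \<bar>r\<bar> * norm S" by (simp add: scaleR_hs_def n inorm_scaleC)
  show "norm S = sqrt (Re (cinner S S))" by (simp add: norm_hs_def)
qed

end

lemma power2_norm_hs: "(norm T)\<^sup>2 = (\<Sum>\<^sub>\<infinity>e\<in>some_onb. (norm (hs_apply T e))\<^sup>2)"
  by (simp add: norm_hs_def cinner_hs_self infsum_nonneg)

lemma sum_le_norm_hs:
  assumes "finite F" "F \<subseteq> some_onb"
  shows "(\<Sum>e\<in>F. (norm (hs_apply T e))\<^sup>2) \<le> (norm T)\<^sup>2"
  unfolding power2_norm_hs using hilbert_schmidt_hs_apply [of T] assms
  by (intro finite_sum_le_infsum) (auto simp: hilbert_schmidt_def)

lemma norm_hs_apply: "norm (hs_apply T x) \<le> norm T * norm x"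
proof -
  note bl = hilbert_schmidt_bounded [OF hilbert_schmidt_hs_apply [of T]]
  note lin = bounded_clinearD [OF bl]
  have cont: "continuous_on UNIV (hs_apply T)"
    using bounded_clinear_bounded_linear [OF bl] by (rule linear_continuous_on)
  have "complex_vector.span some_onb \<subseteq> {x. norm (hs_apply T x) \<le> norm T * norm x}"
  proof
    fix x :: 'a assume "x \<in> complex_vector.span some_onb"
    then obtain F u where F: "finite F" "F \<subseteq> some_onb" and x: "x = (\<Sum>v\<in>F. u v *\<^sub>C v)"
      unfolding complex_vector.span_explicit by blast
    have o: "orthonormal F"
      using is_onb_some_onb [where 'a = 'a] F(2) unfolding is_onb_def orthonormal_def by (meson subsetD)
    have nx: "norm x = L2_set (\<lambda>v. cmod (u v)) F"
      using orthonormal_norm_sum [OF F(1) o, of u] by (simp add: x L2_set_def real_sqrt_unique)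
    have nT: "L2_set (\<lambda>v. norm (hs_apply T v)) F \<le> norm T"
      unfolding L2_set_def using sum_le_norm_hs [OF F, of T] real_le_lsqrt norm_ge_zero by blast
    have "norm (hs_apply T x) \<le> (\<Sum>v\<in>F. \<bar>cmod (u v)\<bar> * \<bar>norm (hs_apply T v)\<bar>)"
      unfolding x clinear_sum [OF lin] clinear_scale [OF lin]
      by (rule order_trans [OF norm_sum]) (simp add: norm_scaleC)
    also have "\<dots> \<le> L2_set (\<lambda>v. cmod (u v)) F * L2_set (\<lambda>v. norm (hs_apply T v)) F"
      by (rule L2_set_mult_ineq)
    also have "\<dots> \<le> norm x * norm T"
      unfolding nx using nT by (intro mult_left_mono) simp_all
    finally show "x \<in> {x. norm (hs_apply T x) \<le> norm T * norm x}" by (simp add: mult.commute)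
  qed
  moreover have "closed {x. norm (hs_apply T x) \<le> norm T * norm x}"
    by (intro closed_Collect_le continuous_intros cont)
  ultimately have "closure (complex_vector.span some_onb) \<subseteq> {x. norm (hs_apply T x) \<le> norm T * norm x}"
    by (rule closure_minimal)
  then show ?thesis using is_onb_some_onb [where 'a = 'a] unfolding is_onb_def by blast
qed

lemma onorm_hs_le: "onorm (hs_apply T) \<le> norm T"
  by (rule onorm_bound) (simp_all add: norm_hs_apply)

instantiation hs :: (chilbert_space) complex_normed_algebra
begin

lift_definition times_hs :: "'a hs \<Rightarrow> 'a hs \<Rightarrow> 'a hs" is "\<lambda>S T x. S (T x)"
  by (rule hilbert_schmidt_compose_left [OF hilbert_schmidt_bounded])

instance
proof
  fix f g h :: "'a hs" and a :: complex and r :: real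
  have R: "r *\<^sub>R f = complex_of_real r *\<^sub>C f" for r and f :: "'a hs" by (simp add: scaleR_hs_def)
  note lin = bounded_clinearD [OF hilbert_schmidt_bounded]
  show "f * g * h = f * (g * h)" "(f + g) * h = f * h + g * h"
    by (transfer, simp)+
  show "f * (g + h) = f * g + f * h"
    by transfer (simp add: clinear_add lin)
  show m1: "(a *\<^sub>C f) * g = a *\<^sub>C (f * g)" for a f and g :: "'a hs"
    by transfer simp
  show m2: "f * (a *\<^sub>C g) = a *\<^sub>C (f * g)" for a f and g :: "'a hs"
    by transfer (simp add: clinear_scale lin)
  show "r *\<^sub>R f * g = r *\<^sub>R (f * g)" "f * r *\<^sub>R g = r *\<^sub>R (f * g)"
    by (simp_all only: R m1 m2)
  show "norm (f * g) \<le> norm f * norm g"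
  proof (rule power2_le_imp_le)
    have sm: "(\<lambda>e. (norm (hs_apply g e))\<^sup>2) summable_on some_onb"
      "(\<lambda>e. (norm (hs_apply (f * g) e))\<^sup>2) summable_on some_onb"
      using hilbert_schmidt_hs_apply unfolding hilbert_schmidt_def by blast+
    have "(norm (f * g))\<^sup>2 \<le> (\<Sum>\<^sub>\<infinity>e\<in>some_onb. (norm f)\<^sup>2 * (norm (hs_apply g e))\<^sup>2)"
      unfolding power2_norm_hs [of "f * g"]
    proof (rule infsum_mono)
      show "(norm (hs_apply (f * g) e))\<^sup>2 \<le> (norm f)\<^sup>2 * (norm (hs_apply g e))\<^sup>2" for e
        using norm_hs_apply [of f "hs_apply g e"]
        by (metis norm_ge_zero power_mono power_mult_distrib times_hs.rep_eq)
    qed (use sm in \<open>auto intro: summable_on_cmult_right\<close>)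
    also have "\<dots> = (norm f * norm g)\<^sup>2"
      unfolding power_mult_distrib power2_norm_hs [of g] using sm(1) by (intro infsum_cmult_right) simp
    finally show "(norm (f * g))\<^sup>2 \<le> (norm f * norm g)\<^sup>2" .
  qed simp
qed

end

lemma norm_hs_leI:
  assumes "0 \<le> c" and "\<And>F. finite F \<Longrightarrow> F \<subseteq> some_onb \<Longrightarrow> (\<Sum>e\<in>F. (norm (hs_apply T e))\<^sup>2) \<le> c\<^sup>2"
  shows "norm T \<le> c"
proof (rule power2_le_imp_le)
  show "(norm T)\<^sup>2 \<le> c\<^sup>2"
    unfolding power2_norm_hs using assms hilbert_schmidt_hs_apply [of T]
    by (intro infsum_le_finite_sums) (auto simp: hilbert_schmidt_def)
qed (rule assms)

instance hs :: (chilbert_space) chilbert_space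
proof
  fix X :: "nat \<Rightarrow> 'a hs" assume X: "Cauchy X"
  let ?B = "\<lambda>T::'a hs. Blinfun (hs_apply T)"
  have bc: "bounded_clinear (hs_apply T)" for T :: "'a hs"
    by (rule hilbert_schmidt_bounded [OF hilbert_schmidt_hs_apply])
  have nB: "norm (?B S - ?B T) \<le> norm (S - T)" for S T :: "'a hs"
  proof -
    have "onorm (hs_apply (S - T)) \<le> norm (S - T)" by (rule onorm_hs_le)
    then show ?thesis
      by (simp add: norm_blinfun.rep_eq minus_blinfun.rep_eq minus_hs.rep_eq
          bounded_linear_Blinfun_apply bounded_clinear_bounded_linear bc)
  qed
  have "Cauchy (\<lambda>n. ?B (X n))"
    unfolding Cauchy_def dist_norm
    using X unfolding Cauchy_def dist_norm by (meson nB order_le_less_trans)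
  then obtain L where L: "(\<lambda>n. ?B (X n)) \<longlonglongrightarrow> L"
    using Cauchy_convergent_iff convergent_def by blast
  have bL: "bounded_clinear (blinfun_apply L)" and lim: "\<And>x. (\<lambda>n. hs_apply (X n) x) \<longlonglongrightarrow> blinfun_apply L x"
    by (rule clinear_limit_Blinfun [OF bc L])+
  have fin: "(\<Sum>e\<in>F. (norm (hs_apply (X n) e - blinfun_apply L e))\<^sup>2) \<le> c\<^sup>2"
    if N: "\<And>m. m \<ge> N \<Longrightarrow> norm (X n - X m) < c" and F: "finite F" "F \<subseteq> some_onb" for F c n N
  proof (rule tendsto_upperbound)
    show "(\<lambda>m. \<Sum>e\<in>F. (norm (hs_apply (X n) e - hs_apply (X m) e))\<^sup>2)
      \<longlonglongrightarrow> (\<Sum>e\<in>F. (norm (hs_apply (X n) e - blinfun_apply L e))\<^sup>2)"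
      by (intro tendsto_intros lim)
    show "\<forall>\<^sub>F m in sequentially. (\<Sum>e\<in>F. (norm (hs_apply (X n) e - hs_apply (X m) e))\<^sup>2) \<le> c\<^sup>2"
      using eventually_ge_at_top [of N]
    proof eventually_elim
      case (elim m)
      have "(\<Sum>e\<in>F. (norm (hs_apply (X n) e - hs_apply (X m) e))\<^sup>2) \<le> (norm (X n - X m))\<^sup>2"
        using sum_le_norm_hs [OF F, of "X n - X m"] by (simp add: minus_hs.rep_eq)
      also have "\<dots> \<le> c\<^sup>2" using N [OF elim] by (intro power_mono) auto
      finally show ?case .
    qed
  qed simp
  obtain N1 where N1: "\<And>m n. m \<ge> N1 \<Longrightarrow> n \<ge> N1 \<Longrightarrow> norm (X m - X n) < 1"
    using CauchyD [OF X, of 1] by auto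
  have "hilbert_schmidt (\<lambda>x. hs_apply (X N1) x - blinfun_apply L x)"
    unfolding hilbert_schmidt_def
  proof
    show "bounded_clinear (\<lambda>x. hs_apply (X N1) x - blinfun_apply L x)"
      by (rule bounded_clinear_sub [OF bc bL])
    show "(\<lambda>e. (norm (hs_apply (X N1) e - blinfun_apply L e))\<^sup>2) summable_on some_onb"
    proof (rule nonneg_bdd_above_summable_on)
      show "bdd_above (sum (\<lambda>e. (norm (hs_apply (X N1) e - blinfun_apply L e))\<^sup>2) ` {F. F \<subseteq> some_onb \<and> finite F})"
        by (intro bdd_aboveI2 [where M = "1\<^sup>2"] fin [where N = N1]) (use N1 in auto)
    qed simp
  qed
  from hilbert_schmidt_diff [OF hilbert_schmidt_hs_apply [of "X N1"] this]
  have hL: "hilbert_schmidt (blinfun_apply L)" by simp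
  define T where "T = HS (blinfun_apply L)"
  have T: "hs_apply T = blinfun_apply L" unfolding T_def by (simp add: HS_inverse hL)
  have "X \<longlonglongrightarrow> T"
  proof (rule LIMSEQ_I)
    fix r :: real assume r: "0 < r"
    obtain N where N: "\<And>m n. m \<ge> N \<Longrightarrow> n \<ge> N \<Longrightarrow> norm (X m - X n) < r / 2"
      using CauchyD [OF X, of "r / 2"] r by auto
    have "norm (X n - T) < r" if "n \<ge> N" for n
    proof -
      have "norm (X n - T) \<le> r / 2"
        using r that by (intro norm_hs_leI) (auto simp: minus_hs.rep_eq T intro!: fin [where N = N] N)
      then show ?thesis using r by simp
    qed
    then show "\<exists>no. \<forall>n\<ge>no. norm (X n - T) < r" by blast
  qed
  then show "convergent X" by (rule convergentI)
qed

instance hs :: (chilbert_space) complex_banach_algebra ..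

section \<open>The algebraic tensor product\<close>

definition cbilinear :: "('a::complex_vector \<Rightarrow> 'b::complex_vector \<Rightarrow> 'c::complex_vector) \<Rightarrow> bool"
  where "cbilinear m \<longleftrightarrow> (\<forall>y. clinear (\<lambda>x. m x y)) \<and> (\<forall>x. clinear (\<lambda>y. m x y))"

lemma cbilinear_add_left: "cbilinear m \<Longrightarrow> m (x + x') y = m x y + m x' y"
  and cbilinear_add_right: "cbilinear m \<Longrightarrow> m x (y + y') = m x y + m x y'"
  and cbilinear_scale_left: "cbilinear m \<Longrightarrow> m (c *\<^sub>C x) y = c *\<^sub>C m x y"
  and cbilinear_scale_right: "cbilinear m \<Longrightarrow> m x (c *\<^sub>C y) = c *\<^sub>C m x y"
  by (simp_all add: cbilinear_def clinear_iff)

lemma cbilinearI: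
  assumes "\<And>x x' y. m (x + x') y = m x y + m x' y" "\<And>x y y'. m x (y + y') = m x y + m x y'"
    "\<And>c x y. m (c *\<^sub>C x) y = c *\<^sub>C m x y" "\<And>c x y. m x (c *\<^sub>C y) = c *\<^sub>C m x y"
  shows "cbilinear m"
  using assms by (simp add: cbilinear_def clinear_iff)

definition tsum :: "('a \<Rightarrow> 'b \<Rightarrow> 'c::comm_monoid_add) \<Rightarrow> ('a \<times> 'b) list \<Rightarrow> 'c"
  where "tsum m xs = (\<Sum>(x, y)\<leftarrow>xs. m x y)"

lemma tsum_simps [simp]:
  "tsum m [] = 0" "tsum m ((x, y) # xs) = m x y + tsum m xs" "tsum m (xs @ ys) = tsum m xs + tsum m ys"
  by (simp_all add: tsum_def)

text \<open>A formal sum \<open>x\<^sub>1 \<otimes> y\<^sub>1 + \<dots> + x\<^sub>n \<otimes> y\<^sub>n\<close> is represented by the list of the pairs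
  \<open>(x\<^sub>i, y\<^sub>i)\<close>.  Two formal sums are the same tensor if no bilinear form separates them;
  \<open>cbilinear_factors\<close> below shows that the resulting space has the universal property
  for bilinear maps into arbitrary complex vector spaces.\<close>

definition tensor_eq :: "('a::complex_vector \<times> 'b::complex_vector) list \<Rightarrow> ('a \<times> 'b) list \<Rightarrow> bool"
  where "tensor_eq xs ys \<longleftrightarrow> (\<forall>m :: 'a \<Rightarrow> 'b \<Rightarrow> complex. cbilinear m \<longrightarrow> tsum m xs = tsum m ys)"

quotient_type (overloaded) ('a, 'b) tensor = "('a::complex_vector \<times> 'b::complex_vector) list" / tensor_eq
  by (rule equivpI) (auto simp: tensor_eq_def reflp_def symp_def transp_def)

lemma tsum_scale: "cbilinear m \<Longrightarrow> tsum m (map (\<lambda>(x, y). (c *\<^sub>C x, y)) xs) = c *\<^sub>C tsum m xs"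
  by (induction xs) (auto simp: cbilinear_scale_left scaleC_add_right)

lemma tsum_neg: "cbilinear m \<Longrightarrow> tsum m (map (\<lambda>(x, y). (- x, y)) xs) = - tsum m xs"
  using tsum_scale [of m "- 1" xs] by (simp add: scaleC_minus1 cong: map_cong)

instantiation tensor :: (complex_vector, complex_vector) complex_vector
begin

lift_definition zero_tensor :: "('a, 'b) tensor" is "[]" .

lift_definition plus_tensor :: "('a, 'b) tensor \<Rightarrow> ('a, 'b) tensor \<Rightarrow> ('a, 'b) tensor" is "(@)"
  by (simp add: tensor_eq_def)

lift_definition uminus_tensor :: "('a, 'b) tensor \<Rightarrow> ('a, 'b) tensor" is "map (\<lambda>(x, y). (- x, y))"
  by (simp add: tensor_eq_def tsum_neg)

definition minus_tensor :: "('a, 'b) tensor \<Rightarrow> ('a, 'b) tensor \<Rightarrow> ('a, 'b) tensor"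
  where "minus_tensor u v = u + - v"

lift_definition scaleC_tensor :: "complex \<Rightarrow> ('a, 'b) tensor \<Rightarrow> ('a, 'b) tensor"
  is "\<lambda>c. map (\<lambda>(x, y). (c *\<^sub>C x, y))"
  by (simp add: tensor_eq_def tsum_scale)

definition scaleR_tensor :: "real \<Rightarrow> ('a, 'b) tensor \<Rightarrow> ('a, 'b) tensor"
  where "scaleR_tensor r u = complex_of_real r *\<^sub>C u"

instance
proof
  fix f g h :: "('a, 'b) tensor" and a b :: complex and r s :: real
  show "r *\<^sub>R f = complex_of_real r *\<^sub>C f" by (simp add: scaleR_tensor_def)
  show "f - g = f + - g" by (simp add: minus_tensor_def)
  show "f + g + h = f + (g + h)" "f + g = g + f" "0 + f = f" "- f + f = 0"
    by (transfer, simp add: tensor_eq_def tsum_neg algebra_simps)+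
  show "a *\<^sub>C (f + g) = a *\<^sub>C f + a *\<^sub>C g"
    by transfer (simp add: tensor_eq_def)
  show "(a + b) *\<^sub>C f = a *\<^sub>C f + b *\<^sub>C f"
    by transfer (unfold tensor_eq_def, intro allI impI, simp only: tsum_simps tsum_scale, simp only: scaleC_add_left)
  show "a *\<^sub>C b *\<^sub>C f = (a * b) *\<^sub>C f"
    by transfer (unfold tensor_eq_def, intro allI impI, simp only: tsum_scale scaleC_scaleC)
  show "1 *\<^sub>C f = f"
    by transfer (unfold tensor_eq_def, intro allI impI, simp only: tsum_scale, simp add: scaleC_one)
qed

end

lift_definition tens :: "'a::complex_vector \<Rightarrow> 'b::complex_vector \<Rightarrow> ('a, 'b) tensor"  (infixr \<open>\<otimes>\<^sub>t\<close> 75)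
  is "\<lambda>x y. [(x, y)]" .

lemma cbilinear_tens: "cbilinear ((\<otimes>\<^sub>t) :: 'a::complex_vector \<Rightarrow> 'b::complex_vector \<Rightarrow> _)"
proof (rule cbilinearI)
  fix x x' :: 'a and y y' :: 'b and c :: complex
  show "(x + x') \<otimes>\<^sub>t y = x \<otimes>\<^sub>t y + x' \<otimes>\<^sub>t y" "x \<otimes>\<^sub>t (y + y') = x \<otimes>\<^sub>t y + x \<otimes>\<^sub>t y'"
    "(c *\<^sub>C x) \<otimes>\<^sub>t y = c *\<^sub>C (x \<otimes>\<^sub>t y)" "x \<otimes>\<^sub>t (c *\<^sub>C y) = c *\<^sub>C (x \<otimes>\<^sub>t y)"
    by (transfer, simp add: tensor_eq_def cbilinear_add_left cbilinear_add_right cbilinear_scale_left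
        cbilinear_scale_right)+
qed

lemma abs_tensor_eq: "abs_tensor xs = tsum (\<otimes>\<^sub>t) xs"
proof (induction xs)
  case Nil
  then show ?case by (simp add: zero_tensor.abs_eq)
next
  case (Cons p xs)
  obtain x y where p: "p = (x, y)" by (cases p)
  have "abs_tensor (p # xs) = abs_tensor [p] + abs_tensor xs" by (simp add: plus_tensor.abs_eq)
  then show ?case by (simp add: Cons.IH p tens.abs_eq)
qed

lemma tensor_cases:
  obtains xs where "u = tsum (\<otimes>\<^sub>t) xs"
  by (metis Quotient3_abs_rep Quotient3_tensor abs_tensor_eq)

lemma exists_separating_functional:
  assumes z: "(z :: 'c::complex_vector) \<noteq> 0"
  shows "\<exists>g :: 'c \<Rightarrow> complex. clinear g \<and> g z = 1"
proof -
  interpret vp: vector_space_pair "scaleC :: complex \<Rightarrow> 'c \<Rightarrow> 'c" "scaleC :: complex \<Rightarrow> complex \<Rightarrow> complex"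
    by (rule vector_space_pair.intro) (rule complex_vector.vector_space_axioms)+
  have "complex_vector.independent {z}" using z by simp
  from vp.linear_independent_extend [OF this, of "\<lambda>_. 1"] show ?thesis by auto
qed

theorem cbilinear_factors:
  fixes m :: "'a::complex_vector \<Rightarrow> 'b::complex_vector \<Rightarrow> 'c::complex_vector"
  assumes m: "cbilinear m"
  shows "\<exists>!h :: ('a, 'b) tensor \<Rightarrow> 'c. clinear h \<and> (\<forall>x y. h (x \<otimes>\<^sub>t y) = m x y)"
proof -
  have clinear_tsum: "g (tsum n xs) = tsum (\<lambda>x y. g (n x y)) xs"
    if "clinear g" for n :: "'a \<Rightarrow> 'b \<Rightarrow> 'e::complex_vector" and g :: "'e \<Rightarrow> 'd::complex_vector" and xs
    by (induction xs) (auto simp: clinear_add [OF that] clinear_0 [OF that])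
  have eq: "tsum m xs = tsum m ys" if "tensor_eq xs ys" for xs ys
  proof (rule ccontr)
    assume "tsum m xs \<noteq> tsum m ys"
    then have "tsum m xs - tsum m ys \<noteq> 0" by simp
    then obtain g :: "'c \<Rightarrow> complex" where g: "clinear g" "g (tsum m xs - tsum m ys) = 1"
      using exists_separating_functional by blast
    have "cbilinear (\<lambda>x y. g (m x y))"
      using m g(1) by (simp add: cbilinear_def clinear_iff)
    then have "g (tsum m xs) = g (tsum m ys)"
      using that by (simp add: tensor_eq_def clinear_tsum [OF g(1)])
    then show False using g by (simp add: clinear_diff)
  qed
  define h where "h u = tsum m (rep_tensor u)" for u
  have h: "h (abs_tensor xs) = tsum m xs" for xs
    unfolding h_def by (rule eq) (metis Quotient3_rep_abs Quotient3_tensor tensor.abs_eq_iff Quotient3_abs_rep)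
  show ?thesis
  proof (rule ex1I)
    show "clinear h \<and> (\<forall>x y. h (x \<otimes>\<^sub>t y) = m x y)"
    proof (intro conjI allI clinearI)
      fix x y show "h (x \<otimes>\<^sub>t y) = m x y" by (simp add: tens.abs_eq h)
    next
      fix u v :: "('a, 'b) tensor" and c
      obtain xs ys where "u = abs_tensor xs" "v = abs_tensor ys" by (metis tensor_cases abs_tensor_eq)
      then show "h (u + v) = h u + h v" "h (c *\<^sub>C u) = c *\<^sub>C h u"
        by (simp_all add: plus_tensor.abs_eq scaleC_tensor.abs_eq h tsum_scale m)
    qed
  next
    fix k assume k: "clinear k \<and> (\<forall>x y. k (x \<otimes>\<^sub>t y) = m x y)"
    have "k u = h u" for u
    proof -
      obtain xs where xs: "u = tsum (\<otimes>\<^sub>t) xs" by (rule tensor_cases)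
      have "k u = tsum m xs" using k by (simp add: xs clinear_tsum)
      also have "\<dots> = h u" by (simp add: xs abs_tensor_eq [symmetric] h)
      finally show ?thesis .
    qed
    then show "k = h" by blast
  qed
qed

definition list_mult :: "('a::times \<times> 'b::times) list \<Rightarrow> ('a \<times> 'b) list \<Rightarrow> ('a \<times> 'b) list"
  where "list_mult xs ys = concat (map (\<lambda>(x, y). map (\<lambda>(x', y'). (x * x', y * y')) ys) xs)"

lemma tsum_list_mult: "tsum m (list_mult xs ys) = tsum (\<lambda>x y. tsum (\<lambda>x' y'. m (x * x') (y * y')) ys) xs"
proof -
  have "tsum m (map (\<lambda>(x', y'). (x * x', y * y')) ys) = tsum (\<lambda>x' y'. m (x * x') (y * y')) ys" for x y
    by (induction ys) auto
  then show ?thesis unfolding list_mult_def by (induction xs) auto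
qed

lemma tsum_fun_add: "tsum (\<lambda>x y. f x y + g x y) xs = tsum f xs + tsum g xs"
  by (induction xs) (auto simp: ac_simps)

lemma tsum_fun_scale: "tsum (\<lambda>x y. c *\<^sub>C f x y) xs = c *\<^sub>C (tsum f xs :: 'a::complex_vector)"
  by (induction xs) (auto simp: scaleC_add_right)

lemma tsum_swap: "tsum (\<lambda>x y. tsum (\<lambda>x' y'. f x y x' y') ys) xs = tsum (\<lambda>x' y'. tsum (\<lambda>x y. f x y x' y') xs) ys"
proof (induction xs)
  case Nil
  show ?case by (induction ys) auto
qed (auto simp: tsum_fun_add)

instantiation tensor :: (complex_algebra, complex_algebra) complex_algebra
begin

lift_definition times_tensor :: "('a, 'b) tensor \<Rightarrow> ('a, 'b) tensor \<Rightarrow> ('a, 'b) tensor" is list_mult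
proof -
  fix xs xs' ys ys' :: "('a \<times> 'b) list"
  assume xs: "tensor_eq xs xs'" and ys: "tensor_eq ys ys'"
  show "tensor_eq (list_mult xs ys) (list_mult xs' ys')"
    unfolding tensor_eq_def
  proof (intro allI impI)
    fix m :: "'a \<Rightarrow> 'b \<Rightarrow> complex" assume m: "cbilinear m"
    note m' = cbilinear_add_left [OF m] cbilinear_add_right [OF m] cbilinear_scale_left [OF m] cbilinear_scale_right [OF m]
    have 1: "cbilinear (\<lambda>x y. m (x * x') (y * y'))" for x' y'
      by (rule cbilinearI) (simp_all add: m' distrib_right mult_scaleC_left)
    have 2: "cbilinear (\<lambda>x' y'. m (x * x') (y * y'))" for x y
      by (rule cbilinearI) (simp_all add: m' distrib_left mult_scaleC_right)
    have "tsum m (list_mult xs ys) = tsum (\<lambda>x y. tsum (\<lambda>x' y'. m (x * x') (y * y')) ys') xs"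
      using ys 2 by (simp add: tsum_list_mult tensor_eq_def)
    also have "\<dots> = tsum m (list_mult xs' ys')"
      unfolding tsum_list_mult tsum_swap [of _ ys'] using xs 1 by (simp add: tensor_eq_def)
    finally show "tsum m (list_mult xs ys) = tsum m (list_mult xs' ys')" .
  qed
qed

instance
proof
  fix f g h :: "('a, 'b) tensor" and a :: complex
  have assoc: "list_mult (list_mult xs ys) zs = list_mult xs (list_mult ys zs)" for xs ys zs :: "('a \<times> 'b) list"
  proof -
    have map: "list_mult (map (\<lambda>(x', y'). (x * x', y * y')) ys) zs
      = map (\<lambda>(x', y'). (x * x', y * y')) (list_mult ys zs)" for x y
      by (induction ys) (auto simp: list_mult_def mult.assoc)
    have app: "list_mult (us @ vs) zs = list_mult us zs @ list_mult vs zs" for us vs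
      by (simp add: list_mult_def)
    show ?thesis
    proof (induction xs)
      case (Cons p xs)
      obtain x y where p: "p = (x, y)" by (cases p)
      have c: "list_mult ((x, y) # xs) ws = map (\<lambda>(x', y'). (x * x', y * y')) ws @ list_mult xs ws" for xs ws
        by (simp add: list_mult_def)
      show ?case by (simp add: p c app map Cons.IH)
    qed (simp add: list_mult_def)
  qed
  show "f * g * h = f * (g * h)" by transfer (simp add: tensor_eq_def assoc)
  show "(f + g) * h = f * h + g * h" "f * (g + h) = f * g + f * h"
    by (transfer, simp add: tensor_eq_def tsum_list_mult tsum_fun_add)+
  show "(a *\<^sub>C f) * g = a *\<^sub>C (f * g)"
  proof transfer
    fix a :: complex and xs ys :: "('a \<times> 'b) list"
    have "tsum m (list_mult (map (\<lambda>(x, y). (a *\<^sub>C x, y)) xs) ys) = a *\<^sub>C tsum m (list_mult xs ys)"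
      if "cbilinear m" for m :: "'a \<Rightarrow> 'b \<Rightarrow> complex"
      unfolding tsum_list_mult
      by (induction xs) (auto simp: mult_scaleC_left cbilinear_scale_left [OF that] tsum_fun_scale scaleC_add_right)
    then show "tensor_eq (list_mult (map (\<lambda>(x, y). (a *\<^sub>C x, y)) xs) ys) (map (\<lambda>(x, y). (a *\<^sub>C x, y)) (list_mult xs ys))"
      by (simp add: tensor_eq_def tsum_scale)
  qed
  show "f * (a *\<^sub>C g) = a *\<^sub>C (f * g)"
  proof transfer
    fix a :: complex and xs ys :: "('a \<times> 'b) list"
    have "tsum m (list_mult xs (map (\<lambda>(x, y). (a *\<^sub>C x, y)) ys)) = a *\<^sub>C tsum m (list_mult xs ys)"
      if "cbilinear m" for m :: "'a \<Rightarrow> 'b \<Rightarrow> complex"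
      unfolding tsum_list_mult tsum_swap [of _ _ xs]
      by (induction ys) (auto simp: mult_scaleC_right cbilinear_scale_left [OF that] tsum_fun_scale scaleC_add_right)
    then show "tensor_eq (list_mult xs (map (\<lambda>(x, y). (a *\<^sub>C x, y)) ys)) (map (\<lambda>(x, y). (a *\<^sub>C x, y)) (list_mult xs ys))"
      by (simp add: tensor_eq_def tsum_scale)
  qed
qed

end

lemma tens_mult: "(x \<otimes>\<^sub>t y) * (x' \<otimes>\<^sub>t y') = (x * x') \<otimes>\<^sub>t (y * y')"
  by transfer (simp add: list_mult_def tensor_eq_def)

(* maps into the completion are to be lifted over tensors, not over lists of pairs *)
lifting_forget tensor.lifting

section \<open>The projective tensor product\<close>

definition proj_norm :: "('a::complex_normed_vector, 'b::complex_normed_vector) tensor \<Rightarrow> real"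
  where "proj_norm u = Inf {(\<Sum>(x, y)\<leftarrow>xs. norm x * norm y) | xs. u = (\<Sum>(x, y)\<leftarrow>xs. x \<otimes>\<^sub>t y)}"

lemma tsum_norm_nonneg: "0 \<le> tsum (\<lambda>x y. norm x * norm y) xs"
  by (induction xs) auto

lemma proj_norm_alt: "proj_norm u = Inf {tsum (\<lambda>x y. norm x * norm y) xs | xs. u = tsum (\<otimes>\<^sub>t) xs}"
  by (simp add: proj_norm_def tsum_def)

lemma proj_norm_nonneg: "0 \<le> proj_norm u"
  unfolding proj_norm_alt
proof (rule cInf_greatest)
  show "{tsum (\<lambda>x y. norm x * norm y) xs | xs. u = tsum (\<otimes>\<^sub>t) xs} \<noteq> {}"
    using tensor_cases [of u] by blast
qed (auto simp: tsum_norm_nonneg)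

lemma proj_norm_le: "proj_norm (tsum (\<otimes>\<^sub>t) xs) \<le> tsum (\<lambda>x y. norm x * norm y) xs"
  unfolding proj_norm_alt
  by (rule cInf_lower) (auto intro: bdd_belowI [where m = 0] simp: tsum_norm_nonneg)

lemma proj_norm_less:
  assumes "proj_norm u < r"
  obtains xs where "u = tsum (\<otimes>\<^sub>t) xs" "tsum (\<lambda>x y. norm x * norm y) xs < r"
proof -
  have "{tsum (\<lambda>x y. norm x * norm y) xs | xs. u = tsum (\<otimes>\<^sub>t) xs} \<noteq> {}"
    using tensor_cases [of u] by blast
  from cInf_lessD [OF this assms [unfolded proj_norm_alt]] that show ?thesis by blast
qed

lemma proj_norm_tens: "proj_norm (x \<otimes>\<^sub>t y) \<le> norm x * norm y"
  using proj_norm_le [of "[(x, y)]"] by simp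

lemma proj_norm_zero [simp]: "proj_norm 0 = 0"
  by (metis antisym proj_norm_le proj_norm_nonneg tsum_simps(1))

lemma proj_norm_triangle: "proj_norm (u + v) \<le> proj_norm u + proj_norm v"
proof (rule field_le_epsilon)
  fix e :: real assume e: "e > 0"
  obtain xs where xs: "u = tsum (\<otimes>\<^sub>t) xs" "tsum (\<lambda>x y. norm x * norm y) xs < proj_norm u + e / 2"
    using proj_norm_less [of u "proj_norm u + e / 2"] e by auto
  obtain ys where ys: "v = tsum (\<otimes>\<^sub>t) ys" "tsum (\<lambda>x y. norm x * norm y) ys < proj_norm v + e / 2"
    using proj_norm_less [of v "proj_norm v + e / 2"] e by auto
  show "proj_norm (u + v) \<le> proj_norm u + proj_norm v + e"
    using proj_norm_le [of "xs @ ys"] xs ys by simp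
qed

lemma proj_norm_scaleC: "proj_norm (c *\<^sub>C u) = cmod c * proj_norm u"
proof -
  have le: "proj_norm (d *\<^sub>C v) \<le> cmod d * proj_norm v" for d and v :: "('a, 'b) tensor"
  proof (rule field_le_epsilon)
    fix e :: real assume e: "e > 0"
    define e' where "e' = e / (cmod d + 1)"
    have e': "e' > 0" using e by (simp add: e'_def add_nonneg_pos)
    have "cmod d * e' \<le> e"
    proof -
      have "cmod d * e' \<le> (cmod d + 1) * e'" using e' by (simp add: distrib_right)
      also have "\<dots> = e" using norm_ge_zero [of d] unfolding e'_def
        by (subst times_divide_eq_right, subst nonzero_mult_div_cancel_left) (auto simp: add_nonneg_eq_0_iff)
      finally show ?thesis .
    qed
    obtain xs where xs: "v = tsum (\<otimes>\<^sub>t) xs" "tsum (\<lambda>x y. norm x * norm y) xs < proj_norm v + e'"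
      using proj_norm_less [of v "proj_norm v + e'"] e' by auto
    have "d *\<^sub>C v = tsum (\<otimes>\<^sub>t) (map (\<lambda>(x, y). (d *\<^sub>C x, y)) xs)"
      by (simp add: xs(1) tsum_scale cbilinear_tens)
    then have "proj_norm (d *\<^sub>C v) \<le> tsum (\<lambda>x y. norm x * norm y) (map (\<lambda>(x, y). (d *\<^sub>C x, y)) xs)"
      by (simp only: proj_norm_le)
    also have "\<dots> = cmod d * tsum (\<lambda>x y. norm x * norm y) xs"
      by (induction xs) (auto simp: norm_scaleC distrib_left)
    also have "\<dots> \<le> cmod d * (proj_norm v + e')" using xs(2) by (intro mult_left_mono) auto
    also have "\<dots> \<le> cmod d * proj_norm v + e" using \<open>cmod d * e' \<le> e\<close> by (simp add: distrib_left)
    finally show "proj_norm (d *\<^sub>C v) \<le> cmod d * proj_norm v + e" .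
  qed
  show ?thesis
  proof (cases "c = 0")
    case False
    have "proj_norm u \<le> cmod (inverse c) * proj_norm (c *\<^sub>C u)"
      using le [of "inverse c" "c *\<^sub>C u"] False by (simp add: scaleC_scaleC scaleC_one)
    then have "proj_norm u \<le> proj_norm (c *\<^sub>C u) / cmod c"
      by (simp add: norm_inverse inverse_eq_divide norm_divide)
    then have "cmod c * proj_norm u \<le> proj_norm (c *\<^sub>C u)" using False by (simp add: field_simps)
    with le [of c u] show ?thesis by simp
  qed simp
qed

lemma proj_norm_minus [simp]: "proj_norm (- u) = proj_norm u"
  using proj_norm_scaleC [of "- 1" u] by (simp add: scaleC_minus1)

lemma proj_norm_minus_commute: "proj_norm (u - v) = proj_norm (v - u)"
  using proj_norm_minus [of "u - v"] by simp

lemma proj_norm_triangle_sub: "\<bar>proj_norm u - proj_norm v\<bar> \<le> proj_norm (u - v)"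
  using proj_norm_triangle [of v "u - v"] proj_norm_triangle [of u "v - u"] proj_norm_minus_commute [of u v]
  by simp

lemma proj_norm_triangle4: "proj_norm (u + v - (u' + v')) \<le> proj_norm (u - u') + proj_norm (v - v')"
  using proj_norm_triangle [of "u - u'" "v - v'"] by (simp add: algebra_simps)

lemma proj_norm_mult:
  fixes u v :: "('a::complex_normed_algebra, 'b::complex_normed_algebra) tensor"
  shows "proj_norm (u * v) \<le> proj_norm u * proj_norm v"
proof -
  have le: "proj_norm (u * v) \<le> r * s" if r: "proj_norm u < r" and s: "proj_norm v < s" for r s
  proof -
    let ?n = "\<lambda>x y. norm x * norm y"
    obtain xs where xs: "u = tsum (\<otimes>\<^sub>t) xs" "tsum ?n xs < r"
      using proj_norm_less [OF r] by auto
    obtain ys where ys: "v = tsum (\<otimes>\<^sub>t) ys" "tsum ?n ys < s"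
      using proj_norm_less [OF s] by auto
    have "u * v = tsum (\<otimes>\<^sub>t) (list_mult xs ys)"
      unfolding xs(1) ys(1) by (simp add: abs_tensor_eq [symmetric] times_tensor.abs_eq)
    then have "proj_norm (u * v) \<le> tsum ?n (list_mult xs ys)" by (simp only: proj_norm_le)
    also have "\<dots> \<le> tsum ?n xs * tsum ?n ys"
    proof -
      have "tsum (\<lambda>x' y'. norm (x * x') * norm (y * y')) ys \<le> (norm x * norm y) * tsum ?n ys" for x :: 'a and y :: 'b
      proof (induction ys)
        case (Cons p ys)
        obtain x' y' where p: "p = (x', y')" by (cases p)
        have "norm (x * x') * norm (y * y') \<le> (norm x * norm x') * (norm y * norm y')"
          by (intro mult_mono norm_mult_ineq) simp_all
        with Cons.IH show ?case by (simp add: p distrib_left ac_simps)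
      qed simp
      then show ?thesis
        unfolding tsum_list_mult
      proof (induction xs)
        case (Cons p xs)
        obtain x y where p: "p = (x, y)" by (cases p)
        show ?case using add_mono [OF Cons.prems [of x y] Cons.IH [OF Cons.prems]] by (simp add: p distrib_right)
      qed simp
    qed
    also have "\<dots> \<le> r * s" using xs(2) ys(2) tsum_norm_nonneg [of ys] tsum_norm_nonneg [of xs]
      by (intro mult_mono) auto
    finally show ?thesis .
  qed
  let ?r = "\<lambda>n. proj_norm u + inverse (real (Suc n))" and ?s = "\<lambda>n. proj_norm v + inverse (real (Suc n))"
  have "(\<lambda>n. ?r n * ?s n) \<longlonglongrightarrow> (proj_norm u + 0) * (proj_norm v + 0)"
    by (intro tendsto_mult tendsto_add tendsto_const LIMSEQ_inverse_real_of_nat)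
  then have "proj_norm (u * v) \<le> (proj_norm u + 0) * (proj_norm v + 0)"
    by (rule tendsto_lowerbound) (auto intro!: always_eventually le)
  then show ?thesis by simp
qed

text \<open>The completion with respect to \<open>proj_norm\<close>: Cauchy sequences of tensors modulo null
  sequences.  That \<open>proj_norm u = 0\<close> only for \<open>u = 0\<close> (a consequence of the Hahn--Banach theorem)
  is not needed for this construction; \<open>norm_ptensor_of\<close> and \<open>closure_range_ptensor_of\<close> below
  say that the tensors form a dense subspace on which the norm is \<open>proj_norm\<close>.\<close>

definition proj_Cauchy :: "(nat \<Rightarrow> ('a::complex_normed_vector, 'b::complex_normed_vector) tensor) \<Rightarrow> bool"
  where "proj_Cauchy X \<longleftrightarrow> (\<forall>e>0. \<exists>N. \<forall>m\<ge>N. \<forall>n\<ge>N. proj_norm (X m - X n) < e)"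

definition ptensor_eq :: "(nat \<Rightarrow> ('a::complex_normed_vector, 'b::complex_normed_vector) tensor)
    \<Rightarrow> (nat \<Rightarrow> ('a, 'b) tensor) \<Rightarrow> bool"
  where "ptensor_eq X Y \<longleftrightarrow> proj_Cauchy X \<and> proj_Cauchy Y \<and> (\<lambda>n. proj_norm (X n - Y n)) \<longlonglongrightarrow> 0"

lemma proj_null_mono:
  assumes "(\<lambda>n. f n) \<longlonglongrightarrow> (0::real)" "\<And>n. proj_norm (X n) \<le> f n"
  shows "(\<lambda>n. proj_norm (X n)) \<longlonglongrightarrow> 0"
  using assms by (intro real_tendsto_sandwich [OF _ _ tendsto_const assms(1)]) (auto simp: proj_norm_nonneg)

lemma proj_Cauchy_const: "proj_Cauchy (\<lambda>n. u)"
  by (simp add: proj_Cauchy_def)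

quotient_type (overloaded) ('a, 'b) ptensor =
    "nat \<Rightarrow> ('a::complex_normed_vector, 'b::complex_normed_vector) tensor" / partial: ptensor_eq
proof (rule part_equivpI)
  have "ptensor_eq (\<lambda>n. 0) (\<lambda>n. 0)" by (simp add: ptensor_eq_def proj_Cauchy_const)
  then show "\<exists>X :: nat \<Rightarrow> ('a, 'b) tensor. ptensor_eq X X" by blast
  show "symp (ptensor_eq :: _ \<Rightarrow> (nat \<Rightarrow> ('a, 'b) tensor) \<Rightarrow> bool)"
    by (rule sympI) (simp add: ptensor_eq_def proj_norm_minus_commute)
  show "transp (ptensor_eq :: _ \<Rightarrow> (nat \<Rightarrow> ('a, 'b) tensor) \<Rightarrow> bool)"
  proof (rule transpI)
    fix X Y Z :: "nat \<Rightarrow> ('a, 'b) tensor"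
    assume XY: "ptensor_eq X Y" and YZ: "ptensor_eq Y Z"
    have "(\<lambda>n. proj_norm (X n - Z n)) \<longlonglongrightarrow> 0"
    proof (rule proj_null_mono)
      show "(\<lambda>n. proj_norm (X n - Y n) + proj_norm (Y n - Z n)) \<longlonglongrightarrow> 0"
        using tendsto_add [of _ 0 _ _ 0] XY YZ unfolding ptensor_eq_def by fastforce
      show "proj_norm (X n - Z n) \<le> proj_norm (X n - Y n) + proj_norm (Y n - Z n)" for n
        using proj_norm_triangle [of "X n - Y n" "Y n - Z n"] by simp
    qed
    then show "ptensor_eq X Z" using XY YZ by (simp add: ptensor_eq_def)
  qed
qed

lemma ptensor_eq_refl: "ptensor_eq X X \<longleftrightarrow> proj_Cauchy X"
  by (simp add: ptensor_eq_def)

lemma ptensor_eqI: "proj_Cauchy X \<Longrightarrow> (\<And>n. X n = Y n) \<Longrightarrow> ptensor_eq X Y"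
  by (metis ext ptensor_eq_refl)

lemma proj_Cauchy_add:
  assumes X: "proj_Cauchy X" and Y: "proj_Cauchy Y"
  shows "proj_Cauchy (\<lambda>n. X n + Y n)"
  unfolding proj_Cauchy_def
proof (intro allI impI)
  fix e :: real assume "e > 0"
  then have e: "e / 2 > 0" by simp
  obtain M where M: "\<And>m n. m \<ge> M \<Longrightarrow> n \<ge> M \<Longrightarrow> proj_norm (X m - X n) < e / 2"
    using X e unfolding proj_Cauchy_def by blast
  obtain N where N: "\<And>m n. m \<ge> N \<Longrightarrow> n \<ge> N \<Longrightarrow> proj_norm (Y m - Y n) < e / 2"
    using Y e unfolding proj_Cauchy_def by blast
  have "proj_norm (X m + Y m - (X n + Y n)) < e" if "m \<ge> max M N" "n \<ge> max M N" for m n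
    using M [of m n] N [of m n] that proj_norm_triangle4 [of "X m" "Y m" "X n" "Y n"] by simp
  then show "\<exists>N. \<forall>m\<ge>N. \<forall>n\<ge>N. proj_norm (X m + Y m - (X n + Y n)) < e" by blast
qed

lemma proj_Cauchy_scaleC:
  assumes X: "proj_Cauchy X"
  shows "proj_Cauchy (\<lambda>n. c *\<^sub>C X n)"
  unfolding proj_Cauchy_def
proof (intro allI impI)
  fix e :: real assume "e > 0"
  then have "e / (cmod c + 1) > 0" by (simp add: add_nonneg_pos)
  then obtain N where N: "\<And>m n. m \<ge> N \<Longrightarrow> n \<ge> N \<Longrightarrow> proj_norm (X m - X n) < e / (cmod c + 1)"
    using X unfolding proj_Cauchy_def by blast
  have "proj_norm (c *\<^sub>C X m - c *\<^sub>C X n) < e" if "m \<ge> N" "n \<ge> N" for m n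
  proof -
    have "proj_norm (c *\<^sub>C X m - c *\<^sub>C X n) = cmod c * proj_norm (X m - X n)"
      by (simp add: scaleC_diff_right [symmetric] proj_norm_scaleC)
    also have "\<dots> \<le> (cmod c + 1) * proj_norm (X m - X n)"
      by (intro mult_right_mono) (simp_all add: proj_norm_nonneg)
    also have "\<dots> < e"
      using N [OF that] by (simp add: pos_less_divide_eq add_nonneg_pos mult.commute)
    finally show ?thesis .
  qed
  then show "\<exists>N. \<forall>m\<ge>N. \<forall>n\<ge>N. proj_norm (c *\<^sub>C X m - c *\<^sub>C X n) < e" by blast
qed

lemma proj_Cauchy_uminus: "proj_Cauchy X \<Longrightarrow> proj_Cauchy (\<lambda>n. - X n)"
  using proj_Cauchy_scaleC [of X "- 1"] by (simp add: scaleC_minus1)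

lemma proj_Cauchy_convergent_norm:
  assumes "proj_Cauchy X"
  shows "convergent (\<lambda>n. proj_norm (X n))"
proof -
  have "Cauchy (\<lambda>n. proj_norm (X n))"
  proof (rule CauchyI)
    fix e :: real assume "e > 0"
    then obtain N where "\<And>m n. m \<ge> N \<Longrightarrow> n \<ge> N \<Longrightarrow> proj_norm (X m - X n) < e"
      using assms unfolding proj_Cauchy_def by blast
    then show "\<exists>M. \<forall>m\<ge>M. \<forall>n\<ge>M. norm (proj_norm (X m) - proj_norm (X n)) < e"
      by (metis real_norm_def order_le_less_trans proj_norm_triangle_sub)
  qed
  then show ?thesis by (simp add: Cauchy_convergent_iff)
qed

lemma proj_Cauchy_bounded:
  assumes "proj_Cauchy X"
  obtains K where "K > 0" "\<And>n. proj_norm (X n) \<le> K"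
proof -
  have "Bseq (\<lambda>n. proj_norm (X n))"
    using proj_Cauchy_convergent_norm [OF assms] by (rule convergent_imp_Bseq)
  then show ?thesis using that unfolding Bseq_def by (auto simp: proj_norm_nonneg)
qed

lemma proj_norm_mult_diff:
  fixes u v u' v' :: "('a::complex_normed_algebra, 'b::complex_normed_algebra) tensor"
  shows "proj_norm (u * v - u' * v') \<le> proj_norm u * proj_norm (v - v') + proj_norm (u - u') * proj_norm v'"
proof -
  have "u * v - u' * v' = u * (v - v') + (u - u') * v'" by (simp add: algebra_simps)
  then show ?thesis
    using proj_norm_triangle [of "u * (v - v')" "(u - u') * v'"] proj_norm_mult [of u "v - v'"]
      proj_norm_mult [of "u - u'" v'] by simp
qed

lemma proj_Cauchy_mult:
  fixes X Y :: "nat \<Rightarrow> ('a::complex_normed_algebra, 'b::complex_normed_algebra) tensor"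
  assumes X: "proj_Cauchy X" and Y: "proj_Cauchy Y"
  shows "proj_Cauchy (\<lambda>n. X n * Y n)"
  unfolding proj_Cauchy_def
proof (intro allI impI)
  obtain K where K: "K > 0" "\<And>n. proj_norm (X n) \<le> K" using proj_Cauchy_bounded [OF X] by blast
  obtain L where L: "L > 0" "\<And>n. proj_norm (Y n) \<le> L" using proj_Cauchy_bounded [OF Y] by blast
  fix e :: real assume e: "e > 0"
  have e': "e / (2 * L) > 0" "e / (2 * K) > 0" using e K L by simp_all
  obtain M where M: "\<And>m n. m \<ge> M \<Longrightarrow> n \<ge> M \<Longrightarrow> proj_norm (X m - X n) < e / (2 * L)"
    using X e'(1) unfolding proj_Cauchy_def by blast
  obtain N where N: "\<And>m n. m \<ge> N \<Longrightarrow> n \<ge> N \<Longrightarrow> proj_norm (Y m - Y n) < e / (2 * K)"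
    using Y e'(2) unfolding proj_Cauchy_def by blast
  have "proj_norm (X m * Y m - X n * Y n) < e" if "m \<ge> max M N" "n \<ge> max M N" for m n
  proof -
    have "proj_norm (X m * Y m - X n * Y n)
      \<le> proj_norm (X m) * proj_norm (Y m - Y n) + proj_norm (X m - X n) * proj_norm (Y n)"
      by (rule proj_norm_mult_diff)
    also have "\<dots> \<le> K * proj_norm (Y m - Y n) + proj_norm (X m - X n) * L"
      by (intro add_mono mult_mono K L) (use K in \<open>auto simp: proj_norm_nonneg\<close>)
    also have "\<dots> < K * (e / (2 * K)) + (e / (2 * L)) * L"
      using M [of m n] N [of m n] that K L
      by (intro add_strict_mono mult_strict_left_mono mult_strict_right_mono) auto
    also have "\<dots> = e" using K L by simp
    finally show ?thesis .
  qed
  then show "\<exists>N. \<forall>m\<ge>N. \<forall>n\<ge>N. proj_norm (X m * Y m - X n * Y n) < e" by blast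
qed

lemma tendsto_proj_norm:
  assumes "proj_Cauchy X"
  shows "(\<lambda>n. proj_norm (X n)) \<longlonglongrightarrow> lim (\<lambda>n. proj_norm (X n))"
  using proj_Cauchy_convergent_norm [OF assms] by (simp add: convergent_LIMSEQ_iff)

instantiation ptensor :: (complex_normed_vector, complex_normed_vector) complex_normed_vector
begin

lift_definition zero_ptensor :: "('a, 'b) ptensor" is "\<lambda>n. 0"
  by (simp add: ptensor_eq_refl proj_Cauchy_const)

lift_definition plus_ptensor :: "('a, 'b) ptensor \<Rightarrow> ('a, 'b) ptensor \<Rightarrow> ('a, 'b) ptensor"
  is "\<lambda>X Y n. X n + Y n"
proof -
  fix X X' Y Y' :: "nat \<Rightarrow> ('a, 'b) tensor"
  assume XX': "ptensor_eq X X'" and YY': "ptensor_eq Y Y'"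
  have "(\<lambda>n. proj_norm (X n + Y n - (X' n + Y' n))) \<longlonglongrightarrow> 0"
  proof (rule proj_null_mono)
    show "(\<lambda>n. proj_norm (X n - X' n) + proj_norm (Y n - Y' n)) \<longlonglongrightarrow> 0"
      using tendsto_add [of _ 0 _ _ 0] XX' YY' unfolding ptensor_eq_def by fastforce
  qed (rule proj_norm_triangle4)
  then show "ptensor_eq (\<lambda>n. X n + Y n) (\<lambda>n. X' n + Y' n)"
    using XX' YY' by (simp add: ptensor_eq_def proj_Cauchy_add)
qed

lift_definition scaleC_ptensor :: "complex \<Rightarrow> ('a, 'b) ptensor \<Rightarrow> ('a, 'b) ptensor"
  is "\<lambda>c X n. c *\<^sub>C X n"
proof -
  fix c and X Y :: "nat \<Rightarrow> ('a, 'b) tensor" assume XY: "ptensor_eq X Y"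
  then have "(\<lambda>n. cmod c * proj_norm (X n - Y n)) \<longlonglongrightarrow> 0"
    by (intro tendsto_mult_right_zero) (simp add: ptensor_eq_def)
  then have "(\<lambda>n. proj_norm (c *\<^sub>C X n - c *\<^sub>C Y n)) \<longlonglongrightarrow> 0"
    by (simp add: scaleC_diff_right [symmetric] proj_norm_scaleC)
  then show "ptensor_eq (\<lambda>n. c *\<^sub>C X n) (\<lambda>n. c *\<^sub>C Y n)"
    using XY by (simp add: ptensor_eq_def proj_Cauchy_scaleC)
qed

lift_definition norm_ptensor :: "('a, 'b) ptensor \<Rightarrow> real" is "\<lambda>X. lim (\<lambda>n. proj_norm (X n))"
proof -
  fix X Y :: "nat \<Rightarrow> ('a, 'b) tensor" assume XY: "ptensor_eq X Y"
  have "(\<lambda>n. proj_norm (X n) - proj_norm (Y n)) \<longlonglongrightarrow> 0"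
  proof (rule Lim_null_comparison)
    show "(\<lambda>n. proj_norm (X n - Y n)) \<longlonglongrightarrow> 0" using XY by (simp add: ptensor_eq_def)
    show "\<forall>\<^sub>F n in sequentially. norm (proj_norm (X n) - proj_norm (Y n)) \<le> proj_norm (X n - Y n)"
      by (simp add: proj_norm_triangle_sub)
  qed
  moreover have "(\<lambda>n. proj_norm (X n) - proj_norm (Y n)) \<longlonglongrightarrow> lim (\<lambda>n. proj_norm (X n)) - lim (\<lambda>n. proj_norm (Y n))"
    using XY by (intro tendsto_diff tendsto_proj_norm) (auto simp: ptensor_eq_def)
  ultimately show "lim (\<lambda>n. proj_norm (X n)) = lim (\<lambda>n. proj_norm (Y n))"
    using LIMSEQ_unique by fastforce
qed

definition uminus_ptensor :: "('a, 'b) ptensor \<Rightarrow> ('a, 'b) ptensor"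
  where "uminus_ptensor u = (- 1) *\<^sub>C u"

definition minus_ptensor :: "('a, 'b) ptensor \<Rightarrow> ('a, 'b) ptensor \<Rightarrow> ('a, 'b) ptensor"
  where "minus_ptensor u v = u + - v"

definition scaleR_ptensor :: "real \<Rightarrow> ('a, 'b) ptensor \<Rightarrow> ('a, 'b) ptensor"
  where "scaleR_ptensor r u = complex_of_real r *\<^sub>C u"

definition dist_ptensor :: "('a, 'b) ptensor \<Rightarrow> ('a, 'b) ptensor \<Rightarrow> real"
  where "dist_ptensor u v = norm (u - v)"

definition sgn_ptensor :: "('a, 'b) ptensor \<Rightarrow> ('a, 'b) ptensor"
  where "sgn_ptensor u = inverse (norm u) *\<^sub>R u"

definition uniformity_ptensor :: "(('a, 'b) ptensor \<times> ('a, 'b) ptensor) filter"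
  where "uniformity_ptensor = (INF e\<in>{0 <..}. principal {(x, y). dist x y < e})"

definition open_ptensor :: "('a, 'b) ptensor set \<Rightarrow> bool"
  where "open_ptensor S = (\<forall>x\<in>S. \<forall>\<^sub>F (x', y) in uniformity. x' = x \<longrightarrow> y \<in> S)"

instance
proof
  fix f g h :: "('a, 'b) ptensor" and a b :: complex and r s :: real
  show R: "r *\<^sub>R f = complex_of_real r *\<^sub>C f" for r and f :: "('a, 'b) ptensor" by (simp add: scaleR_ptensor_def)
  show "f - g = f + - g" by (simp add: minus_ptensor_def)
  show "f + g + h = f + (g + h)"
    by transfer (simp add: ptensor_eq_refl ptensor_eqI proj_Cauchy_add add.assoc)
  show "f + g = g + f"
    by transfer (simp add: ptensor_eq_refl ptensor_eqI proj_Cauchy_add add.commute)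
  show "0 + f = f" by transfer simp
  show "- f + f = 0" unfolding uminus_ptensor_def
    by transfer (simp add: ptensor_eq_refl proj_Cauchy_const scaleC_minus1)
  show add_right: "a *\<^sub>C (f + g) = a *\<^sub>C f + a *\<^sub>C g" for a and f g :: "('a, 'b) ptensor"
    by transfer (simp add: ptensor_eq_refl ptensor_eqI proj_Cauchy_add proj_Cauchy_scaleC scaleC_add_right)
  show add_left: "(a + b) *\<^sub>C f = a *\<^sub>C f + b *\<^sub>C f" for a b and f :: "('a, 'b) ptensor"
    by transfer (simp add: ptensor_eq_refl ptensor_eqI proj_Cauchy_add proj_Cauchy_scaleC scaleC_add_left)
  show assoc: "a *\<^sub>C b *\<^sub>C f = (a * b) *\<^sub>C f" for a b and f :: "('a, 'b) ptensor"
    by transfer (simp add: ptensor_eq_refl ptensor_eqI proj_Cauchy_scaleC scaleC_scaleC)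
  show one: "1 *\<^sub>C f = f" for f :: "('a, 'b) ptensor"
    by transfer (simp add: scaleC_one)
  show "r *\<^sub>R (f + g) = r *\<^sub>R f + r *\<^sub>R g" "(r + s) *\<^sub>R f = r *\<^sub>R f + s *\<^sub>R f"
    "r *\<^sub>R s *\<^sub>R f = (r * s) *\<^sub>R f" "1 *\<^sub>R f = f"
    by (simp_all add: R add_right add_left assoc one)
  show "dist f g = norm (f - g)" by (simp add: dist_ptensor_def)
  show "sgn f = inverse (norm f) *\<^sub>R f" by (simp add: sgn_ptensor_def)
  show "uniformity = (INF e\<in>{0 <..}. principal {(x, y::('a, 'b) ptensor). dist x y < e})"
    by (simp add: uniformity_ptensor_def)
  show "open S = (\<forall>x\<in>S. \<forall>\<^sub>F (x', y) in uniformity. x' = x \<longrightarrow> y \<in> S)" for S :: "('a, 'b) ptensor set"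
    by (simp add: open_ptensor_def)
  show "norm f = 0 \<longleftrightarrow> f = 0"
  proof transfer
    fix X :: "nat \<Rightarrow> ('a, 'b) tensor" assume "ptensor_eq X X"
    then have X: "proj_Cauchy X" by (simp add: ptensor_eq_refl)
    show "(lim (\<lambda>n. proj_norm (X n)) = 0) = ptensor_eq X (\<lambda>n. 0)"
      using tendsto_proj_norm [OF X] X limI [of "\<lambda>n. proj_norm (X n)" 0]
      by (auto simp: ptensor_eq_def proj_Cauchy_const)
  qed
  show "norm (f + g) \<le> norm f + norm g"
  proof transfer
    fix X Y :: "nat \<Rightarrow> ('a, 'b) tensor" assume "ptensor_eq X X" "ptensor_eq Y Y"
    then have XY: "proj_Cauchy X" "proj_Cauchy Y" by (simp_all add: ptensor_eq_refl)
    show "lim (\<lambda>n. proj_norm (X n + Y n)) \<le> lim (\<lambda>n. proj_norm (X n)) + lim (\<lambda>n. proj_norm (Y n))"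
      by (rule LIMSEQ_le [OF tendsto_proj_norm tendsto_add [OF tendsto_proj_norm tendsto_proj_norm]])
         (auto intro: XY proj_Cauchy_add proj_norm_triangle)
  qed
  show nC: "norm (a *\<^sub>C f) = cmod a * norm f" for a and f :: "('a, 'b) ptensor"
  proof transfer
    fix a and X :: "nat \<Rightarrow> ('a, 'b) tensor" assume "ptensor_eq X X"
    then have "proj_Cauchy X" by (simp add: ptensor_eq_refl)
    then have "(\<lambda>n. cmod a * proj_norm (X n)) \<longlonglongrightarrow> cmod a * lim (\<lambda>n. proj_norm (X n))"
      by (intro tendsto_mult_left tendsto_proj_norm)
    then show "lim (\<lambda>n. proj_norm (a *\<^sub>C X n)) = cmod a * lim (\<lambda>n. proj_norm (X n))"
      unfolding proj_norm_scaleC by (rule limI)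
  qed
  show "norm (r *\<^sub>R f) = \<bar>r\<bar> * norm f" by (simp add: R nC)
qed

end

lift_definition ptensor_of :: "('a::complex_normed_vector, 'b::complex_normed_vector) tensor \<Rightarrow> ('a, 'b) ptensor"
  is "\<lambda>u n. u"
  by (simp add: ptensor_eq_refl proj_Cauchy_const)

lemma norm_ptensor_of: "norm (ptensor_of u) = proj_norm u"
  by transfer (simp add: limI)

lemma ptensor_of_add: "ptensor_of (u + v) = ptensor_of u + ptensor_of v"
  by transfer (simp add: ptensor_eq_refl proj_Cauchy_const)

lemma ptensor_of_scaleC: "ptensor_of (c *\<^sub>C u) = c *\<^sub>C ptensor_of u"
  by transfer (simp add: ptensor_eq_refl proj_Cauchy_const)

lemma ptensor_of_diff: "ptensor_of (u - v) = ptensor_of u - ptensor_of v"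
  using ptensor_of_add [of u "(- 1) *\<^sub>C v"] ptensor_of_scaleC [of "- 1" v] by (simp add: scaleC_minus1)

lemma ptensor_cases:
  obtains X where "proj_Cauchy X" "u = abs_ptensor X"
proof -
  have "u = abs_ptensor (rep_ptensor u)" "proj_Cauchy (rep_ptensor u)"
    by (simp_all add: Quotient3_abs_rep [OF Quotient3_ptensor] ptensor_eq_refl [symmetric]
        Quotient3_rep_reflp [OF Quotient3_ptensor])
  then show ?thesis using that by blast
qed

lemma ptensor_of_tendsto:
  assumes X: "proj_Cauchy X"
  shows "(\<lambda>n. ptensor_of (X n)) \<longlonglongrightarrow> abs_ptensor X"
proof (rule LIMSEQ_I)
  have n: "norm (ptensor_of u - abs_ptensor X) = lim (\<lambda>k. proj_norm (u - X k))" for u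
  proof -
    have "- abs_ptensor X = abs_ptensor (\<lambda>k. - X k)"
      unfolding uminus_ptensor_def using X
      by (subst scaleC_ptensor.abs_eq) (simp_all only: ptensor_eq_refl scaleC_minus1)
    then have "ptensor_of u - abs_ptensor X = abs_ptensor (\<lambda>k. u - X k)"
      unfolding minus_ptensor_def using X
      by (simp add: ptensor_of_def plus_ptensor.abs_eq ptensor_eq_refl proj_Cauchy_const proj_Cauchy_uminus)
    then show ?thesis
      using proj_Cauchy_add [OF proj_Cauchy_const proj_Cauchy_uminus [OF X], of u]
      by (simp add: norm_ptensor.abs_eq ptensor_eq_refl)
  qed
  fix e :: real assume "e > 0"
  then obtain N where N: "\<And>m n. m \<ge> N \<Longrightarrow> n \<ge> N \<Longrightarrow> proj_norm (X m - X n) < e / 2"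
    using X unfolding proj_Cauchy_def by (meson half_gt_zero)
  have "norm (ptensor_of (X m) - abs_ptensor X) < e" if "m \<ge> N" for m
  proof -
    have "proj_Cauchy (\<lambda>k. X m - X k)"
      using proj_Cauchy_add [OF proj_Cauchy_const proj_Cauchy_uminus [OF X], of "X m"] by simp
    from tendsto_proj_norm [OF this] have "lim (\<lambda>k. proj_norm (X m - X k)) \<le> e / 2"
      by (rule tendsto_upperbound)
         (use N that in \<open>auto simp: eventually_sequentially intro!: exI [of _ N] less_imp_le\<close>)
    then show ?thesis using \<open>e > 0\<close> by (simp add: n)
  qed
  then show "\<exists>no. \<forall>n\<ge>no. norm (ptensor_of (X n) - abs_ptensor X) < e" by blast
qed

lemma closure_range_ptensor_of: "closure (range ptensor_of) = UNIV"
proof -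
  have "u \<in> closure (range ptensor_of)" for u :: "('a, 'b) ptensor"
  proof -
    obtain X where X: "proj_Cauchy X" "u = abs_ptensor X" by (rule ptensor_cases)
    show ?thesis unfolding closure_sequential X(2)
      using ptensor_of_tendsto [OF X(1)] by (intro CollectI exI [of _ "\<lambda>n. ptensor_of (X n)"]) simp
  qed
  then show ?thesis by blast
qed

instantiation ptensor :: (complex_normed_algebra, complex_normed_algebra) complex_normed_algebra
begin

lift_definition times_ptensor :: "('a, 'b) ptensor \<Rightarrow> ('a, 'b) ptensor \<Rightarrow> ('a, 'b) ptensor"
  is "\<lambda>X Y n. X n * Y n"
proof -
  fix X X' Y Y' :: "nat \<Rightarrow> ('a, 'b) tensor"
  assume XX': "ptensor_eq X X'" and YY': "ptensor_eq Y Y'"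
  have C: "proj_Cauchy X" "proj_Cauchy X'" "proj_Cauchy Y" "proj_Cauchy Y'"
    using XX' YY' by (simp_all add: ptensor_eq_def)
  have "(\<lambda>n. proj_norm (X n * Y n - X' n * Y' n)) \<longlonglongrightarrow> 0"
  proof (rule proj_null_mono)
    have "(\<lambda>n. proj_norm (X n) * proj_norm (Y n - Y' n) + proj_norm (X n - X' n) * proj_norm (Y' n))
      \<longlonglongrightarrow> lim (\<lambda>n. proj_norm (X n)) * 0 + 0 * lim (\<lambda>n. proj_norm (Y' n))"
      using XX' YY' by (intro tendsto_add tendsto_mult tendsto_proj_norm C) (auto simp: ptensor_eq_def)
    then show "(\<lambda>n. proj_norm (X n) * proj_norm (Y n - Y' n) + proj_norm (X n - X' n) * proj_norm (Y' n)) \<longlonglongrightarrow> 0"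
      by simp
  qed (rule proj_norm_mult_diff)
  then show "ptensor_eq (\<lambda>n. X n * Y n) (\<lambda>n. X' n * Y' n)"
    using C by (simp add: ptensor_eq_def proj_Cauchy_mult)
qed

instance
proof
  fix f g h :: "('a, 'b) ptensor" and a :: complex and r :: real
  have R: "r *\<^sub>R f = complex_of_real r *\<^sub>C f" for r and f :: "('a, 'b) ptensor" by (simp add: scaleR_ptensor_def)
  show "f * g * h = f * (g * h)"
    by transfer (simp add: ptensor_eq_refl ptensor_eqI proj_Cauchy_mult mult.assoc)
  show "(f + g) * h = f * h + g * h"
    by transfer (simp add: ptensor_eq_refl ptensor_eqI proj_Cauchy_mult proj_Cauchy_add distrib_right)
  show "f * (g + h) = f * g + f * h"
    by transfer (simp add: ptensor_eq_refl ptensor_eqI proj_Cauchy_mult proj_Cauchy_add distrib_left)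
  show m1: "(a *\<^sub>C f) * g = a *\<^sub>C (f * g)" for a and f g :: "('a, 'b) ptensor"
    by transfer (simp add: ptensor_eq_refl ptensor_eqI proj_Cauchy_mult proj_Cauchy_scaleC mult_scaleC_left)
  show m2: "f * (a *\<^sub>C g) = a *\<^sub>C (f * g)" for a and f g :: "('a, 'b) ptensor"
    by transfer (simp add: ptensor_eq_refl ptensor_eqI proj_Cauchy_mult proj_Cauchy_scaleC mult_scaleC_right)
  show "r *\<^sub>R f * g = r *\<^sub>R (f * g)" "f * r *\<^sub>R g = r *\<^sub>R (f * g)"
    by (simp_all only: R m1 m2)
  show "norm (f * g) \<le> norm f * norm g"
  proof transfer
    fix X Y :: "nat \<Rightarrow> ('a, 'b) tensor" assume "ptensor_eq X X" "ptensor_eq Y Y"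
    then have XY: "proj_Cauchy X" "proj_Cauchy Y" by (simp_all add: ptensor_eq_refl)
    show "lim (\<lambda>n. proj_norm (X n * Y n)) \<le> lim (\<lambda>n. proj_norm (X n)) * lim (\<lambda>n. proj_norm (Y n))"
      by (rule LIMSEQ_le [OF tendsto_proj_norm tendsto_mult [OF tendsto_proj_norm tendsto_proj_norm]])
         (auto intro: XY proj_Cauchy_mult proj_norm_mult)
  qed
qed

end

lemma ptensor_of_mult: "ptensor_of (u * v) = ptensor_of u * ptensor_of v"
  by transfer (simp add: ptensor_eq_refl proj_Cauchy_const)

instance ptensor :: (complex_normed_vector, complex_normed_vector) complex_banach
proof
  fix P :: "nat \<Rightarrow> ('a, 'b) ptensor" assume P: "Cauchy P"
  have "\<exists>u. norm (P n - ptensor_of u) < inverse (real (Suc n))" for n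
  proof -
    have "P n \<in> closure (range ptensor_of)" by (simp add: closure_range_ptensor_of)
    then obtain v where "v \<in> range ptensor_of" "dist v (P n) < inverse (real (Suc n))"
      unfolding closure_approachable by (meson inverse_positive_iff_positive of_nat_0_less_iff zero_less_Suc)
    then show ?thesis by (auto simp: dist_norm norm_minus_commute)
  qed
  then obtain X where X: "\<And>n. norm (P n - ptensor_of (X n)) < inverse (real (Suc n))" by metis
  have null: "(\<lambda>n. ptensor_of (X n) - P n) \<longlonglongrightarrow> 0"
    by (rule Lim_null_comparison [OF _ LIMSEQ_inverse_real_of_nat])
       (use X in \<open>auto intro!: always_eventually less_imp_le simp: norm_minus_commute\<close>)
  have "Cauchy (\<lambda>n. ptensor_of (X n))"
  proof (rule CauchyI)
    fix e :: real assume "e > 0"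
    then have e: "e / 3 > 0" by simp
    obtain M where M: "\<And>n. n \<ge> M \<Longrightarrow> norm (ptensor_of (X n) - P n) < e / 3"
      using LIMSEQ_D [OF null e] by auto
    obtain N where N: "\<And>m n. m \<ge> N \<Longrightarrow> n \<ge> N \<Longrightarrow> norm (P m - P n) < e / 3"
      using CauchyD [OF P e] by blast
    have "norm (ptensor_of (X m) - ptensor_of (X n)) < e" if "m \<ge> max M N" "n \<ge> max M N" for m n
    proof -
      have "ptensor_of (X m) - ptensor_of (X n)
        = (ptensor_of (X m) - P m) + (P m - P n) - (ptensor_of (X n) - P n)" by simp
      then have "norm (ptensor_of (X m) - ptensor_of (X n))
        \<le> norm (ptensor_of (X m) - P m) + norm (P m - P n) + norm (ptensor_of (X n) - P n)"
        using norm_triangle_ineq4 [of "(ptensor_of (X m) - P m) + (P m - P n)" "ptensor_of (X n) - P n"]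
          norm_triangle_ineq [of "ptensor_of (X m) - P m" "P m - P n"] by simp
      then show ?thesis using M [of m] M [of n] N [of m n] that by simp
    qed
    then show "\<exists>K. \<forall>m\<ge>K. \<forall>n\<ge>K. norm (ptensor_of (X m) - ptensor_of (X n)) < e" by blast
  qed
  then have "proj_Cauchy X"
    unfolding Cauchy_iff proj_Cauchy_def by (simp add: ptensor_of_diff [symmetric] norm_ptensor_of)
  then have "(\<lambda>n. ptensor_of (X n)) \<longlonglongrightarrow> abs_ptensor X" by (rule ptensor_of_tendsto)
  then have "(\<lambda>n. ptensor_of (X n) - (ptensor_of (X n) - P n)) \<longlonglongrightarrow> abs_ptensor X - 0"
    using null by (rule tendsto_diff)
  then show "convergent P" by (simp add: convergentI)
qed

instance ptensor :: (complex_normed_algebra, complex_normed_algebra) complex_banach_algebra ..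

section \<open>Arens regularity\<close>

type_synonym 'a cbidual = "'a cdual cdual"

lemma bounded_clinear_cdual_apply: "bounded_clinear (cdual_apply f)"
  using cdual_apply by blast

lemma cdual_apply_add: "cdual_apply f (x + y) = cdual_apply f x + cdual_apply f y"
  and cdual_apply_scaleC: "cdual_apply f (c *\<^sub>C x) = c *\<^sub>C cdual_apply f x"
  by (simp_all add: clinear_add clinear_scale bounded_clinearD bounded_clinear_cdual_apply)

lemma norm_cdual_apply: "cmod (cdual_apply f x) \<le> norm f * norm x"
  unfolding norm_cdual.rep_eq
  by (rule onorm [OF bounded_clinear_bounded_linear [OF bounded_clinear_cdual_apply]])

lemma norm_cdual_leI: "0 \<le> K \<Longrightarrow> (\<And>x. cmod (cdual_apply f x) \<le> K * norm x) \<Longrightarrow> norm f \<le> K"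
  unfolding norm_cdual.rep_eq by (rule onorm_bound)

text \<open>In the notation \<open>\<omega>\<^sub>a(b) = \<omega>(ab)\<close>, \<open>\<^sub>a\<omega>(b) = \<omega>(ba)\<close>, \<open>\<omega>\<^sub>f(a) = f(\<^sub>a\<omega>)\<close>, \<open>\<^sub>f\<omega>(a) = f(\<omega>\<^sub>a)\<close>
  the following functionals are \<open>\<omega>\<^sub>a\<close>, \<open>\<^sub>a\<omega>\<close>, \<open>\<omega>\<^sub>f\<close>, \<open>\<^sub>f\<omega>\<close>, in this order.\<close>

lift_definition dual_r :: "'a::complex_normed_algebra cdual \<Rightarrow> 'a \<Rightarrow> 'a cdual"
  is "\<lambda>\<omega> a b. \<omega> (a * b)"
proof -
  fix \<omega> :: "'a \<Rightarrow> complex" and a :: 'a assume w: "bounded_clinear \<omega>"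
  have "bounded_clinear (\<lambda>b. a * b)"
    by (simp add: bounded_clinear_iff bounded_linear_mult_right mult_scaleC_right)
  with w show "bounded_clinear (\<lambda>b. \<omega> (a * b))" by (rule bounded_clinear_compose)
qed

lift_definition dual_l :: "'a::complex_normed_algebra \<Rightarrow> 'a cdual \<Rightarrow> 'a cdual"
  is "\<lambda>a \<omega> b. \<omega> (b * a)"
proof -
  fix \<omega> :: "'a \<Rightarrow> complex" and a :: 'a assume w: "bounded_clinear \<omega>"
  have "bounded_clinear (\<lambda>b. b * a)"
    by (simp add: bounded_clinear_iff bounded_linear_mult_left mult_scaleC_left)
  with w show "bounded_clinear (\<lambda>b. \<omega> (b * a))" by (rule bounded_clinear_compose)
qed

definition bidual_r :: "'a::complex_normed_algebra cdual \<Rightarrow> 'a cbidual \<Rightarrow> 'a cdual"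
  where "bidual_r \<omega> f = CDual (\<lambda>a. cdual_apply f (dual_l a \<omega>))"

definition bidual_l :: "'a::complex_normed_algebra cbidual \<Rightarrow> 'a cdual \<Rightarrow> 'a cdual"
  where "bidual_l f \<omega> = CDual (\<lambda>a. cdual_apply f (dual_r \<omega> a))"

lemma norm_dual_r: "norm (dual_r \<omega> a) \<le> norm \<omega> * norm a"
proof (rule norm_cdual_leI)
  show "cmod (cdual_apply (dual_r \<omega> a) b) \<le> norm \<omega> * norm a * norm b" for b
    using order_trans [OF norm_cdual_apply [of \<omega> "a * b"] mult_left_mono [OF norm_mult_ineq [of a b] norm_ge_zero]]
    by (simp add: dual_r.rep_eq mult.assoc)
qed simp

lemma norm_dual_l: "norm (dual_l a \<omega>) \<le> norm \<omega> * norm a"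
proof (rule norm_cdual_leI)
  show "cmod (cdual_apply (dual_l a \<omega>) b) \<le> norm \<omega> * norm a * norm b" for b
    using order_trans [OF norm_cdual_apply [of \<omega> "b * a"] mult_left_mono [OF norm_mult_ineq [of b a] norm_ge_zero]]
    by (simp add: dual_l.rep_eq ac_simps)
qed simp

lemma dual_r_linear: "dual_r \<omega> (a + b) = dual_r \<omega> a + dual_r \<omega> b" "dual_r \<omega> (c *\<^sub>C a) = c *\<^sub>C dual_r \<omega> a"
  "dual_r (\<omega> + \<phi>) a = dual_r \<omega> a + dual_r \<phi> a" "dual_r (c *\<^sub>C \<omega>) a = c *\<^sub>C dual_r \<omega> a"
  by (transfer, simp add: distrib_right mult_scaleC_left clinear_add clinear_scale bounded_clinearD)+

lemma dual_l_linear: "dual_l (a + b) \<omega> = dual_l a \<omega> + dual_l b \<omega>" "dual_l (c *\<^sub>C a) \<omega> = c *\<^sub>C dual_l a \<omega>"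
  "dual_l a (\<omega> + \<phi>) = dual_l a \<omega> + dual_l a \<phi>" "dual_l a (c *\<^sub>C \<omega>) = c *\<^sub>C dual_l a \<omega>"
  by (transfer, simp add: distrib_left mult_scaleC_right clinear_add clinear_scale bounded_clinearD)+

lemma bidual_r_apply: "cdual_apply (bidual_r \<omega> f) a = cdual_apply f (dual_l a \<omega>)"
proof -
  have "bounded_clinear (\<lambda>a. cdual_apply f (dual_l a \<omega>))"
  proof (rule bounded_clinearI)
    show "norm (cdual_apply f (dual_l a \<omega>)) \<le> (norm f * norm \<omega>) * norm a" for a
      using order_trans [OF norm_cdual_apply [of f] mult_left_mono [OF norm_dual_l norm_ge_zero]]
      by (simp add: mult.assoc)
  qed (simp_all add: dual_l_linear cdual_apply_add cdual_apply_scaleC)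
  then show ?thesis unfolding bidual_r_def by (simp add: CDual_inverse)
qed

lemma bidual_l_apply: "cdual_apply (bidual_l f \<omega>) a = cdual_apply f (dual_r \<omega> a)"
proof -
  have "bounded_clinear (\<lambda>a. cdual_apply f (dual_r \<omega> a))"
  proof (rule bounded_clinearI)
    show "norm (cdual_apply f (dual_r \<omega> a)) \<le> (norm f * norm \<omega>) * norm a" for a
      using order_trans [OF norm_cdual_apply [of f] mult_left_mono [OF norm_dual_r norm_ge_zero]]
      by (simp add: mult.assoc)
  qed (simp_all add: dual_r_linear cdual_apply_add cdual_apply_scaleC)
  then show ?thesis unfolding bidual_l_def by (simp add: CDual_inverse)
qed

lemma cdual_eqI: "(\<And>x. cdual_apply f x = cdual_apply g x) \<Longrightarrow> f = g"
  by transfer auto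

lemma bidual_r_linear: "bidual_r (\<omega> + \<phi>) f = bidual_r \<omega> f + bidual_r \<phi> f" "bidual_r (c *\<^sub>C \<omega>) f = c *\<^sub>C bidual_r \<omega> f"
  by (rule cdual_eqI, simp add: bidual_r_apply plus_cdual.rep_eq scaleC_cdual.rep_eq dual_l_linear
      cdual_apply_add cdual_apply_scaleC)+

lemma bidual_l_linear: "bidual_l f (\<omega> + \<phi>) = bidual_l f \<omega> + bidual_l f \<phi>" "bidual_l f (c *\<^sub>C \<omega>) = c *\<^sub>C bidual_l f \<omega>"
  by (rule cdual_eqI, simp add: bidual_l_apply plus_cdual.rep_eq scaleC_cdual.rep_eq dual_r_linear
      cdual_apply_add cdual_apply_scaleC)+

lemma norm_bidual_r: "norm (bidual_r \<omega> f) \<le> norm f * norm \<omega>"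
proof (rule norm_cdual_leI)
  show "cmod (cdual_apply (bidual_r \<omega> f) a) \<le> norm f * norm \<omega> * norm a" for a
    unfolding bidual_r_apply
    using order_trans [OF norm_cdual_apply [of f] mult_left_mono [OF norm_dual_l norm_ge_zero]]
    by (simp add: mult.assoc)
qed simp

lemma norm_bidual_l: "norm (bidual_l f \<omega>) \<le> norm f * norm \<omega>"
proof (rule norm_cdual_leI)
  show "cmod (cdual_apply (bidual_l f \<omega>) a) \<le> norm f * norm \<omega> * norm a" for a
    unfolding bidual_l_apply
    using order_trans [OF norm_cdual_apply [of f] mult_left_mono [OF norm_dual_r norm_ge_zero]]
    by (simp add: mult.assoc)
qed simp

definition arens_box :: "'a::complex_normed_algebra cbidual \<Rightarrow> 'a cbidual \<Rightarrow> 'a cbidual"  (infixl \<open>\<box>\<^sub>A\<close> 70)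
  where "f \<box>\<^sub>A g = CDual (\<lambda>\<omega>. cdual_apply f (bidual_l g \<omega>))"

definition arens_diamond :: "'a::complex_normed_algebra cbidual \<Rightarrow> 'a cbidual \<Rightarrow> 'a cbidual"  (infixl \<open>\<diamond>\<^sub>A\<close> 70)
  where "f \<diamond>\<^sub>A g = CDual (\<lambda>\<omega>. cdual_apply g (bidual_r \<omega> f))"

lemma arens_box_apply: "cdual_apply (f \<box>\<^sub>A g) \<omega> = cdual_apply f (bidual_l g \<omega>)"
proof -
  have "bounded_clinear (\<lambda>\<omega>. cdual_apply f (bidual_l g \<omega>))"
  proof (rule bounded_clinearI)
    show "norm (cdual_apply f (bidual_l g \<omega>)) \<le> (norm f * norm g) * norm \<omega>" for \<omega>
      using order_trans [OF norm_cdual_apply [of f] mult_left_mono [OF norm_bidual_l norm_ge_zero]]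
      by (simp add: mult.assoc)
  qed (simp_all add: bidual_l_linear cdual_apply_add cdual_apply_scaleC)
  then show ?thesis unfolding arens_box_def by (simp add: CDual_inverse)
qed

lemma arens_diamond_apply: "cdual_apply (f \<diamond>\<^sub>A g) \<omega> = cdual_apply g (bidual_r \<omega> f)"
proof -
  have "bounded_clinear (\<lambda>\<omega>. cdual_apply g (bidual_r \<omega> f))"
  proof (rule bounded_clinearI)
    show "norm (cdual_apply g (bidual_r \<omega> f)) \<le> (norm g * norm f) * norm \<omega>" for \<omega>
      using order_trans [OF norm_cdual_apply [of g] mult_left_mono [OF norm_bidual_r norm_ge_zero]]
      by (simp add: mult.assoc)
  qed (simp_all add: bidual_r_linear cdual_apply_add cdual_apply_scaleC)
  then show ?thesis unfolding arens_diamond_def by (simp add: CDual_inverse)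
qed

definition arens_regular :: "'a::complex_normed_algebra itself \<Rightarrow> bool"
  where "arens_regular _ \<longleftrightarrow> (\<forall>f g :: 'a cbidual. f \<box>\<^sub>A g = f \<diamond>\<^sub>A g)"

end

theory Submission
  imports Defs
begin

text \<open>If \<open>f\<close> and \<open>g\<close> are weak-star cluster points of bounded sequences \<open>u\<close> and \<open>v\<close>, then
  \<open>f \<box> g\<close> and \<open>f \<diamond> g\<close> evaluate at \<open>\<omega>\<close> to the two iterated limits of \<open>\<omega> (u\<^sub>m v\<^sub>n)\<close>, so it suffices
  to make these differ.  With matrix units \<open>E\<^sub>i\<^sub>j\<close>, take \<open>\<omega> (S \<otimes> X) = \<langle>S X, E\<^sub>0\<^sub>0\<rangle>\<close>,
  \<open>u\<^sub>m = S\<^sub>m \<otimes> E\<^sub>m\<^sub>0\<close> and \<open>v\<^sub>n = T\<^sub>n \<otimes> E\<^sub>0\<^sub>n\<close>, where \<open>S\<^sub>m\<close> sends \<open>E\<^sub>m\<^sub>0\<close> to \<open>E\<^sub>0\<^sub>0\<close> and the partial isometry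
  \<open>T\<^sub>n\<close> sends \<open>E\<^sub>i\<^sub>n\<close> to \<open>E\<^sub>i\<^sub>0\<close> exactly for \<open>i \<le> n\<close>.  Since \<open>E\<^sub>m\<^sub>0 E\<^sub>0\<^sub>n = E\<^sub>m\<^sub>n\<close>, the value
  \<open>\<omega> (u\<^sub>m v\<^sub>n)\<close> is \<open>1\<close> if \<open>m \<le> n\<close> and \<open>0\<close> otherwise.\<close>

text \<open>This is the Banach-Alaoglu argument. The evaluations at the \<open>u n\<close> lie in a
  product of closed discs, compact by Tychonoff, so they cluster at some point \<open>h\<close> of
  the product. One such \<open>h\<close> then serves every functional at once.\<close>

lemma bounded_seq_weak_star_cluster_point:
  fixes u :: "nat \<Rightarrow> 'a::complex_normed_vector"
  assumes u: "\<And>n. norm (u n) \<le> C"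
  shows "\<exists>f :: 'a cbidual. \<forall>\<omega> l. (\<lambda>n. cdual_apply \<omega> (u n)) \<longlonglongrightarrow> l \<longrightarrow> cdual_apply f \<omega> = l"
proof -
  have C0: "0 \<le> C" using norm_ge_zero u order_trans by blast
  define \<phi> where "\<phi> n = (\<lambda>\<omega>. cdual_apply \<omega> (u n))" for n
  define K where "K = Pi\<^sub>E UNIV (\<lambda>\<omega> :: 'a cdual. cball (0::complex) (C * norm \<omega>))"
  have "compactin (product_topology (\<lambda>_::'a cdual. euclidean) UNIV) K"
    unfolding K_def compactin_PiE by simp
  then have "compact K" by (simp add: euclidean_product_topology)
  moreover have \<phi>K: "\<phi> n \<in> K" for n
    using order_trans [OF norm_cdual_apply mult_left_mono [OF u norm_ge_zero]]
    by (auto simp: K_def \<phi>_def mult.commute)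
  ultimately obtain h where h: "h \<in> K" "inf (nhds h) (filtermap \<phi> sequentially) \<noteq> bot"
    unfolding compact_filter
    by (elim allE [of _ "filtermap \<phi> sequentially"]) (auto simp: eventually_filtermap filtermap_bot_iff)
  \<comment> \<open>Everything needed about \<open>h\<close> except its bound comes from here:
    additivity, homogeneity and closeness to a limit are closed conditions on finitely many
    coordinates, and coordinates are continuous in the product topology.\<close>
  have closedD: "h \<in> S" if "closed S" "eventually (\<lambda>n. \<phi> n \<in> S) sequentially" for S
  proof (rule ccontr)
    assume "h \<notin> S"
    then have "eventually (\<lambda>x. x \<in> - S) (nhds h)"
      using that(1) by (intro eventually_nhds_in_open) auto
    moreover have "eventually (\<lambda>x. x \<in> S) (filtermap \<phi> sequentially)"
      using that(2) by (simp add: eventually_filtermap)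
    ultimately have "eventually (\<lambda>x. False) (inf (nhds h) (filtermap \<phi> sequentially))"
      unfolding eventually_inf by (intro exI conjI) auto
    then show False using h(2) by (simp add: trivial_limit_def)
  qed
  have cont: "continuous_on UNIV (\<lambda>g :: 'a cdual \<Rightarrow> complex. g \<omega>)" for \<omega>
    by (rule continuous_on_product_coordinates)
  have "h \<in> {g. g (\<omega> + \<psi>) = g \<omega> + g \<psi>}" for \<omega> \<psi>
    by (intro closedD closed_Collect_eq continuous_intros cont) (simp add: \<phi>_def plus_cdual.rep_eq)
  moreover have "h \<in> {g. g (c *\<^sub>C \<omega>) = c * g \<omega>}" for c \<omega>
    by (intro closedD closed_Collect_eq continuous_intros cont)
       (simp add: \<phi>_def scaleC_cdual.rep_eq scaleC_complex_def)
  moreover have "cmod (h \<omega>) \<le> C * norm \<omega>" for \<omega>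
    using h(1) by (auto simp: K_def)
  ultimately have "bounded_clinear h"
    by (intro bounded_clinearI) (auto simp: scaleC_complex_def)
  then have app: "cdual_apply (CDual h) = h" by (simp add: CDual_inverse)
  show ?thesis
  proof (intro exI [of _ "CDual h"] allI impI)
    fix \<omega> l assume lim: "(\<lambda>n. cdual_apply \<omega> (u n)) \<longlonglongrightarrow> l"
    have "dist (h \<omega>) l \<le> e" if "e > 0" for e
    proof -
      have "h \<in> {g. dist (g \<omega>) l \<le> e}"
        using tendstoD [OF lim that]
        by (intro closedD closed_Collect_le continuous_intros cont) (auto simp: \<phi>_def elim: eventually_mono)
      then show ?thesis by simp
    qed
    then have "dist (h \<omega>) l \<le> 0" by (rule field_le_epsilon) simp
    then show "cdual_apply (CDual h) \<omega> = l" by (simp add: app)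
  qed
qed

lemma not_arens_regularI:
  fixes u v :: "nat \<Rightarrow> 'a::complex_normed_algebra" and \<omega> :: "'a cdual"
  assumes u: "\<And>m. norm (u m) \<le> C" and v: "\<And>n. norm (v n) \<le> D"
    and a: "\<And>m. (\<lambda>n. cdual_apply \<omega> (u m * v n)) \<longlonglongrightarrow> a m" "a \<longlonglongrightarrow> \<alpha>"
    and b: "\<And>n. (\<lambda>m. cdual_apply \<omega> (u m * v n)) \<longlonglongrightarrow> b n" "b \<longlonglongrightarrow> \<beta>"
    and ne: "\<alpha> \<noteq> \<beta>"
  shows "\<not> arens_regular TYPE('a)"
proof -
  obtain f where f: "\<forall>\<omega> l. (\<lambda>n. cdual_apply \<omega> (u n)) \<longlonglongrightarrow> l \<longrightarrow> cdual_apply f \<omega> = l"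
    using bounded_seq_weak_star_cluster_point [of u, OF u] by blast
  obtain g where g: "\<forall>\<omega> l. (\<lambda>n. cdual_apply \<omega> (v n)) \<longlonglongrightarrow> l \<longrightarrow> cdual_apply g \<omega> = l"
    using bounded_seq_weak_star_cluster_point [of v, OF v] by blast
  \<comment> \<open>In the box product \<open>g\<close> takes the limit over \<open>n\<close> first
    and \<open>f\<close> the limit over \<open>m\<close> afterwards; the diamond product below
    reverses the order.\<close>
  have "cdual_apply (bidual_l g \<omega>) (u m) = a m" for m
    unfolding bidual_l_apply using a(1) by (intro g [rule_format]) (simp add: dual_r.rep_eq)
  then have "cdual_apply (f \<box>\<^sub>A g) \<omega> = \<alpha>"
    unfolding arens_box_apply using a(2) by (intro f [rule_format]) simp
  moreover have "cdual_apply (bidual_r \<omega> f) (v n) = b n" for n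
    unfolding bidual_r_apply using b(1) by (intro f [rule_format]) (simp add: dual_l.rep_eq)
  then have "cdual_apply (f \<diamond>\<^sub>A g) \<omega> = \<beta>"
    unfolding arens_diamond_apply using b(2) by (intro g [rule_format]) simp
  ultimately show ?thesis using ne unfolding arens_regular_def by metis
qed

text \<open>The form is linearised on the algebraic tensor product by its universal property. The
  bound on elementary tensors passes to \<open>proj_norm\<close> through near-optimal
  representations, and a bounded linear map extends from a dense subspace to the completion.\<close>

lemma bounded_cbilinear_extends_to_ptensor:
  fixes m :: "'a::complex_normed_vector \<Rightarrow> 'b::complex_normed_vector \<Rightarrow> complex"
  assumes m: "cbilinear m" and bd: "\<And>x y. cmod (m x y) \<le> C * (norm x * norm y)" and C: "0 \<le> C"
  shows "\<exists>\<omega> :: ('a, 'b) ptensor cdual. \<forall>x y. cdual_apply \<omega> (ptensor_of (x \<otimes>\<^sub>t y)) = m x y"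
proof -
  obtain h where h: "clinear h" "\<And>x y. h (x \<otimes>\<^sub>t y) = m x y"
    using cbilinear_factors [OF m] by blast
  have tsum_le: "cmod (h (tsum (\<otimes>\<^sub>t) xs)) \<le> C * tsum (\<lambda>x y. norm x * norm y) xs" for xs
  proof (induction xs)
    case Nil
    show ?case by (simp add: clinear_0 [OF h(1)])
  next
    case (Cons p xs)
    obtain x y where p: "p = (x, y)" by (cases p)
    show ?case
      unfolding p using norm_triangle_mono [OF bd [of x y] Cons.IH]
      by (simp add: clinear_add [OF h(1)] h(2) algebra_simps)
  qed
  have hn: "cmod (h u) \<le> C * norm (ptensor_of u)" for u
  proof (rule field_le_epsilon)
    fix e :: real assume e: "e > 0"
    \<comment> \<open>The denominator \<open>C + 1\<close> also covers \<open>C = 0\<close>.\<close>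
    have "proj_norm u < proj_norm u + e / (C + 1)" using C e by simp
    then obtain xs where xs: "u = tsum (\<otimes>\<^sub>t) xs"
      "tsum (\<lambda>x y. norm x * norm y) xs < proj_norm u + e / (C + 1)" by (rule proj_norm_less)
    have "cmod (h u) \<le> C * (proj_norm u + e / (C + 1))"
      unfolding xs(1) using tsum_le [of xs] mult_left_mono [OF less_imp_le [OF xs(2)] C] xs(1) by simp
    also have "\<dots> \<le> C * norm (ptensor_of u) + e"
      using C e by (simp add: norm_ptensor_of field_simps)
    finally show "cmod (h u) \<le> C * norm (ptensor_of u) + e" .
  qed
  have hd: "cmod (h u - h v) \<le> C * norm (ptensor_of u - ptensor_of v)" for u v
    using hn [of "u - v"] by (simp add: clinear_diff [OF h(1)] ptensor_of_diff)
  have "\<exists>X. (\<lambda>n. ptensor_of (X n)) \<longlonglongrightarrow> p" for p :: "('a, 'b) ptensor"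
    by (metis ptensor_cases ptensor_of_tendsto)
  then obtain R where R: "\<And>p :: ('a, 'b) ptensor. (\<lambda>n. ptensor_of (R p n)) \<longlonglongrightarrow> p" by metis
  define \<omega> where "\<omega> p = lim (\<lambda>n. h (R p n))" for p
  have hR: "(\<lambda>n. h (R p n)) \<longlonglongrightarrow> \<omega> p" for p
  proof -
    have "Cauchy (\<lambda>n. h (R p n))"
    proof (rule CauchyI)
      fix e :: real assume e: "e > 0"
      then have "e / (C + 1) > 0" using C by simp
      from CauchyD [OF LIMSEQ_imp_Cauchy [OF R [of p]] this]
      obtain N where N: "\<And>i j. i \<ge> N \<Longrightarrow> j \<ge> N \<Longrightarrow> norm (ptensor_of (R p i) - ptensor_of (R p j)) < e / (C + 1)"
        by blast
      have "norm (h (R p i) - h (R p j)) < e" if "i \<ge> N" "j \<ge> N" for i j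
      proof -
        have "norm (h (R p i) - h (R p j)) \<le> C * (e / (C + 1))"
          using hd [of "R p i" "R p j"] mult_left_mono [OF less_imp_le [OF N [OF that]] C] by linarith
        also have "\<dots> < e" using C e by (simp add: field_simps)
        finally show ?thesis .
      qed
      then show "\<exists>N. \<forall>i\<ge>N. \<forall>j\<ge>N. norm (h (R p i) - h (R p j)) < e" by blast
    qed
    then show ?thesis unfolding \<omega>_def by (simp add: Cauchy_convergent convergent_LIMSEQ_iff [symmetric])
  qed
  \<comment> \<open>The value of \<open>\<omega>\<close> does not depend on the chosen sequence
    \<open>R p\<close>. Hence linearity can be tested on sums and multiples of chosen sequences, and
    the value on an elementary tensor on a constant sequence.\<close>
  have hX: "(\<lambda>n. h (X n)) \<longlonglongrightarrow> \<omega> p" if "(\<lambda>n. ptensor_of (X n)) \<longlonglongrightarrow> p" for X p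
  proof -
    have "(\<lambda>n. C * norm (ptensor_of (X n) - ptensor_of (R p n))) \<longlonglongrightarrow> C * norm (p - p)"
      by (intro tendsto_mult tendsto_const tendsto_norm tendsto_diff that R)
    then have "(\<lambda>n. C * norm (ptensor_of (X n) - ptensor_of (R p n))) \<longlonglongrightarrow> 0" by simp
    then have "(\<lambda>n. h (X n) - h (R p n)) \<longlonglongrightarrow> 0"
      by (rule Lim_null_comparison [rotated]) (simp add: hd)
    from tendsto_add [OF this hR [of p]] show ?thesis by simp
  qed
  have "bounded_clinear \<omega>"
  proof (rule bounded_clinearI)
    fix p q :: "('a, 'b) ptensor" and c
    show "\<omega> (p + q) = \<omega> p + \<omega> q"
    proof (rule LIMSEQ_unique [OF hX])
      show "(\<lambda>n. ptensor_of (R p n + R q n)) \<longlonglongrightarrow> p + q"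
        unfolding ptensor_of_add by (intro tendsto_add R)
      show "(\<lambda>n. h (R p n + R q n)) \<longlonglongrightarrow> \<omega> p + \<omega> q"
        unfolding clinear_add [OF h(1)] by (intro tendsto_add hR)
    qed
    show "\<omega> (c *\<^sub>C p) = c *\<^sub>C \<omega> p"
    proof (rule LIMSEQ_unique [OF hX])
      show "(\<lambda>n. ptensor_of (c *\<^sub>C R p n)) \<longlonglongrightarrow> c *\<^sub>C p"
        unfolding ptensor_of_scaleC by (intro tendsto_scaleC R)
      show "(\<lambda>n. h (c *\<^sub>C R p n)) \<longlonglongrightarrow> c *\<^sub>C \<omega> p"
        unfolding clinear_scale [OF h(1)] by (intro tendsto_scaleC hR)
    qed
    show "norm (\<omega> p) \<le> C * norm p"
      by (rule LIMSEQ_le [OF tendsto_norm [OF hR] tendsto_mult [OF tendsto_const tendsto_norm [OF R]]])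
         (use hn in auto)
  qed
  then have app: "cdual_apply (CDual \<omega>) = \<omega>" by (simp add: CDual_inverse)
  show ?thesis
  proof (intro exI [of _ "CDual \<omega>"] allI)
    fix x :: 'a and y :: 'b
    show "cdual_apply (CDual \<omega>) (ptensor_of (x \<otimes>\<^sub>t y)) = m x y"
      unfolding app using LIMSEQ_unique [OF hX [of "\<lambda>_. x \<otimes>\<^sub>t y"] tendsto_const] by (simp add: h(2))
  qed
qed

text \<open>An orthonormal basis only has dense span, whereas infinite dimension is stated through
  algebraic span. For a finite basis, Parseval leaves no remainder after the Fourier sum of
  \<open>x\<close>, which closes this gap.\<close>

lemma finite_onb_span:
  assumes "finite B" and B: "is_onb (B :: 'a::chilbert_space set)"
  shows "complex_vector.span B = UNIV"
proof -
  have "x \<in> complex_vector.span B" for x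
  proof -
    have "(norm (x - (\<Sum>v\<in>B. cinner x v *\<^sub>C v)))\<^sup>2 = (norm x)\<^sup>2 - (\<Sum>v\<in>B. (cmod (cinner x v))\<^sup>2)"
      using norm_diff_sum_orthonormal [OF assms(1)] B by (simp add: is_onb_def)
    also have "\<dots> = 0"
      using has_sum_unique [OF parseval [OF B, of x] has_sum_finite [OF assms(1)]] by simp
    finally have "x = (\<Sum>v\<in>B. cinner x v *\<^sub>C v)" by simp
    also have "\<dots> \<in> complex_vector.span B"
      by (intro complex_vector.span_sum complex_vector.span_scale complex_vector.span_base)
    finally show ?thesis .
  qed
  then show ?thesis by blast
qed

lift_definition rank_one :: "'a::chilbert_space \<Rightarrow> 'a \<Rightarrow> 'a hs"
  is "\<lambda>a b x. cinner x b *\<^sub>C a"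
proof -
  fix a b :: 'a
  have "bounded_clinear (\<lambda>x. cinner x b *\<^sub>C a)"
  proof (rule bounded_clinearI)
    show "norm (cinner x b *\<^sub>C a) \<le> (norm b * norm a) * norm x" for x
      using mult_right_mono [OF cinner_Cauchy_Schwarz [of x b] norm_ge_zero [of a]]
      by (simp add: norm_scaleC ac_simps)
  qed (simp_all add: cinner_add_left cinner_scaleC_left scaleC_add_left scaleC_scaleC)
  \<comment> \<open>Up to the factor \<open>(norm a)\<^sup>2\<close> this is the Parseval series of
    \<open>b\<close>.\<close>
  moreover have "(\<lambda>e. (norm (cinner e b *\<^sub>C a))\<^sup>2) summable_on some_onb"
  proof -
    have "cmod (cinner e b) = cmod (cinner b e)" for e by (subst cinner_commute) simp
    then show ?thesis
      using summable_on_cmult_left [OF has_sum_imp_summable [OF parseval [OF is_onb_some_onb, of b]], of "(norm a)\<^sup>2"]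
      by (simp add: norm_scaleC power_mult_distrib)
  qed
  ultimately show "hilbert_schmidt (\<lambda>x. cinner x b *\<^sub>C a)" by (simp add: hilbert_schmidt_def)
qed

lemma rank_one_mult: "rank_one a b * rank_one c d = cinner c b *\<^sub>C rank_one a d"
  by transfer (simp add: fun_eq_iff cinner_scaleC_left scaleC_scaleC mult.commute)

lemma some_onb_cinner: "e \<in> some_onb \<Longrightarrow> f \<in> some_onb \<Longrightarrow> cinner e f = (if e = f then 1 else 0)"
  using is_onb_some_onb [where 'a = 'a] unfolding is_onb_def orthonormal_def by (auto simp: cinner_self)

text \<open>The Hilbert-Schmidt inner product is a sum over \<open>some_onb\<close>. With
  \<open>b\<close> and \<open>d\<close> taken from that basis, only the term at \<open>b\<close> can
  survive.\<close>

lemma cinner_rank_one: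
  assumes b: "b \<in> some_onb" and d: "d \<in> some_onb"
  shows "cinner (rank_one a b) (rank_one c d) = (if b = d then cinner a c else 0)"
proof -
  have "cinner (rank_one a b) (rank_one c d)
    = (\<Sum>\<^sub>\<infinity>e\<in>some_onb. cinner (cinner e b *\<^sub>C a) (cinner e d *\<^sub>C c))"
    by (simp add: cinner_hs_eq rank_one.rep_eq)
  also have "\<dots> = (\<Sum>\<^sub>\<infinity>e\<in>{b}. cinner (cinner e b *\<^sub>C a) (cinner e d *\<^sub>C c))"
    using b by (intro infsum_cong_neutral) (auto simp: some_onb_cinner)
  also have "\<dots> = (if b = d then cinner a c else 0)"
    using b d by (simp add: some_onb_cinner cinner_scaleC_left cinner_scaleC_right)
  finally show ?thesis .
qed

text \<open>Orthonormality of \<open>b\<close> turns the norm into the sum of the squared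
  coefficients, which Bessel's inequality for \<open>a\<close> bounds.\<close>

lemma norm_sum_cinner_scaleC_le:
  fixes a :: "'i \<Rightarrow> 'a::complex_inner" and b :: "'i \<Rightarrow> 'b::complex_inner"
  assumes I: "finite I"
    and a: "\<And>i j. i \<in> I \<Longrightarrow> j \<in> I \<Longrightarrow> cinner (a i) (a j) = (if i = j then 1 else 0)"
    and b: "\<And>i j. i \<in> I \<Longrightarrow> j \<in> I \<Longrightarrow> cinner (b i) (b j) = (if i = j then 1 else 0)"
  shows "norm (\<Sum>i\<in>I. cinner x (a i) *\<^sub>C b i) \<le> norm x"
proof -
  have on: "inj_on c I \<and> orthonormal (c ` I)"
    if c: "\<And>i j. i \<in> I \<Longrightarrow> j \<in> I \<Longrightarrow> cinner (c i) (c j) = (if i = j then 1 else 0)"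
    for c :: "'i \<Rightarrow> 'c::complex_inner"
  proof
    show inj: "inj_on c I" by (rule inj_onI) (metis c zero_neq_one)
    have "norm (c i) = 1" if "i \<in> I" for i
      using c [OF that that] by (simp add: norm_eq_sqrt_cinner)
    then show "orthonormal (c ` I)" unfolding orthonormal_def using c by auto
  qed
  have A: "inj_on a I" "orthonormal (a ` I)" and B: "inj_on b I" "orthonormal (b ` I)"
    using on [of a] on [of b] a b by blast+
  \<comment> \<open>Reindexing is required because \<open>orthonormal_norm_sum\<close> and
    \<open>bessel\<close> speak of sets of vectors, not of families.\<close>
  have "(norm (\<Sum>i\<in>I. cinner x (a i) *\<^sub>C b i))\<^sup>2
    = (norm (\<Sum>v\<in>b ` I. cinner x (a (inv_into I b v)) *\<^sub>C v))\<^sup>2"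
    using B(1) by (simp add: sum.reindex)
  also have "\<dots> = (\<Sum>v\<in>b ` I. (cmod (cinner x (a (inv_into I b v))))\<^sup>2)"
    using I B(2) by (simp add: orthonormal_norm_sum)
  also have "\<dots> = (\<Sum>v\<in>a ` I. (cmod (cinner x v))\<^sup>2)"
    using A(1) B(1) by (simp add: sum.reindex)
  also have "\<dots> \<le> (norm x)\<^sup>2" using I A(2) by (simp add: bessel)
  finally show ?thesis by (rule power2_le_imp_le) simp
qed

lemma bounded_clinear_bop_apply: "bounded_clinear (bop_apply T)"
  using bop_apply by blast

lemma norm_Bop_le:
  assumes "bounded_clinear T" "0 \<le> C" "\<And>x. norm (T x) \<le> C * norm x"
  shows "norm (Bop T) \<le> C"
  using assms by (simp add: norm_bop.rep_eq Bop_inverse onorm_bound)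

theorem theorem4p6:
  assumes "\<nexists>B :: 'h::chilbert_space set. finite B \<and> complex_vector.span B = UNIV"
  shows "\<not> arens_regular TYPE(('h hs bop, 'h hs) ptensor)"
proof -
  have "infinite (some_onb :: 'h set)"
    using assms finite_onb_span is_onb_some_onb by blast
  then obtain s :: "nat \<Rightarrow> 'h" where s: "inj s" "range s \<subseteq> some_onb"
    using infinite_countable_subset by blast
  have s_onb: "s i \<in> some_onb" for i using s(2) by blast
  have s_cinner: "cinner (s i) (s j) = (if i = j then 1 else 0)" for i j
    using s(1) by (simp add: some_onb_cinner s_onb inj_eq)
  define E where "E i j = rank_one (s i) (s j)" for i j
  have E_cinner: "cinner (E i j) (E k l) = (if i = k \<and> j = l then 1 else 0)" for i j k l
    using s(1) by (simp add: E_def cinner_rank_one s_onb s_cinner inj_eq)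
  have E_mult: "E i 0 * E 0 j = E i j" for i j
    by (simp add: E_def rank_one_mult s_cinner scaleC_one)
  have E_norm: "norm (E i j) = 1" for i j
    by (simp add: norm_eq_sqrt_cinner E_cinner)

  have "cbilinear (\<lambda>(S :: 'h hs bop) x. cinner (bop_apply S x) (E 0 0))"
    by (intro cbilinearI) (simp_all add: plus_bop.rep_eq scaleC_bop.rep_eq
        clinear_add [OF bounded_clinearD [OF bounded_clinear_bop_apply]]
        clinear_scale [OF bounded_clinearD [OF bounded_clinear_bop_apply]]
        cinner_add_left cinner_scaleC_left scaleC_complex_def)
  moreover have "cmod (cinner (bop_apply S x) (E 0 0)) \<le> 1 * (norm S * norm x)" for S :: "'h hs bop" and x
    using cinner_Cauchy_Schwarz [of "bop_apply S x" "E 0 0"]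
      onorm [OF bounded_clinear_bounded_linear [OF bounded_clinear_bop_apply], of S x]
    by (simp add: E_norm norm_bop.rep_eq)
  ultimately obtain \<omega> :: "('h hs bop, 'h hs) ptensor cdual"
    where \<omega>: "\<And>S x. cdual_apply \<omega> (ptensor_of (S \<otimes>\<^sub>t x)) = cinner (bop_apply S x) (E 0 0)"
    using bounded_cbilinear_extends_to_ptensor [of "\<lambda>S x. cinner (bop_apply S x) (E 0 0)" 1] by auto

  define S where "S m = (\<lambda>X. cinner X (E m 0) *\<^sub>C E 0 0)" for m
  define T where "T n = (\<lambda>X. \<Sum>i\<le>n. cinner X (E i n) *\<^sub>C E i 0)" for n
  have S_norm: "norm (S m X) \<le> 1 * norm X" for m X
    using cinner_Cauchy_Schwarz [of X "E m 0"] by (simp add: S_def norm_scaleC E_norm)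
  have S_bc: "bounded_clinear (S m)" for m
    by (rule bounded_clinearI [OF _ _ S_norm])
       (simp_all add: S_def cinner_add_left cinner_scaleC_left scaleC_add_left scaleC_scaleC)
  \<comment> \<open>For fixed \<open>n\<close> both \<open>E i n\<close> and \<open>E i 0\<close>
    are orthonormal in \<open>i\<close>, so the bound is uniform in \<open>n\<close>; the triangle
    inequality alone would give a bound growing with \<open>n\<close>.\<close>
  have T_norm: "norm (T n X) \<le> 1 * norm X" for n X
    unfolding T_def mult_1 by (rule norm_sum_cinner_scaleC_le) (simp_all add: E_cinner)
  have T_bc: "bounded_clinear (T n)" for n
    by (rule bounded_clinearI [OF _ _ T_norm])
       (simp_all add: T_def cinner_add_left cinner_scaleC_left scaleC_add_left
         complex_vector.scale_sum_right scaleC_scaleC sum.distrib)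
  have T_E: "T n (E m n) = (if m \<le> n then E m 0 else 0)" for m n
  proof -
    have "T n (E m n) = (\<Sum>i\<le>n. if m = i then E i 0 else 0)"
      unfolding T_def by (rule sum.cong) (auto simp: E_cinner scaleC_one)
    then show ?thesis by simp
  qed

  define u where "u m = ptensor_of (Bop (S m) \<otimes>\<^sub>t E m 0)" for m
  define v where "v n = ptensor_of (Bop (T n) \<otimes>\<^sub>t E 0 n)" for n
  \<comment> \<open>The product is the tensor of \<open>Bop (S m) * Bop (T n)\<close> with
    \<open>E m n\<close>. The cutoff in \<open>T n\<close> kills \<open>E m n\<close> when
    \<open>m > n\<close>; otherwise \<open>S m\<close> carries \<open>E m 0\<close> on to
    \<open>E 0 0\<close>.\<close>
  have uv: "cdual_apply \<omega> (u m * v n) = (if m \<le> n then 1 else 0)" for m n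
    by (simp add: u_def v_def ptensor_of_mult [symmetric] tens_mult E_mult \<omega> times_bop.rep_eq
        Bop_inverse S_bc T_bc T_E) (simp add: S_def E_cinner scaleC_one)
  show ?thesis
  proof (rule not_arens_regularI [where \<omega> = \<omega> and u = u and v = v and C = 1 and D = 1
        and \<alpha> = 1 and \<beta> = 0])
    show "norm (u m) \<le> 1" for m
      using order_trans [OF proj_norm_tens [of "Bop (S m)" "E m 0"]] norm_Bop_le [OF S_bc _ S_norm]
      by (simp add: u_def norm_ptensor_of E_norm)
    show "norm (v n) \<le> 1" for n
      using order_trans [OF proj_norm_tens [of "Bop (T n)" "E 0 n"]] norm_Bop_le [OF T_bc _ T_norm]
      by (simp add: v_def norm_ptensor_of E_norm)
    show "(\<lambda>n. cdual_apply \<omega> (u m * v n)) \<longlonglongrightarrow> 1" for m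
      unfolding uv by (rule tendsto_eventually) (auto simp: eventually_sequentially)
    \<comment> \<open>The value at \<open>m = n\<close> is still \<open>1\<close>, so the sequence
      vanishes only from \<open>Suc n\<close> on.\<close>
    show "(\<lambda>m. cdual_apply \<omega> (u m * v n)) \<longlonglongrightarrow> 0" for n
      unfolding uv by (rule tendsto_eventually) (auto simp: eventually_sequentially intro!: exI [of _ "Suc n"])
  qed simp_all
qed

end
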